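(* Let $G$ be a finite abelian group and let $A$, $B$, $S$ be non-empty subsets of $G$. Suppose that $$\min\{|A|,|B|\}\geq 9|S|^2-5|S|-3.$$ Then $$|A\oplus_S B|\geq \min\{|A|+|B|-|S|-2,\ p(G)\}.$$
   Context: For subsets $A,B,S$ of an abelian group $G$ (written additively), the generalized restricted sumset is $A\oplus_S B:=\{a+b:\ a\in A,\ b\in B,\ a-b\notin S\}$. For a finite group $G$ with $|G|>1$, $p(G)$ denotes the least prime factor of $|G|$. *)

theory Defs
  imports "HOL-Computational_Algebra.Primes"
begin

definition restricted_sumset :: "'a::ab_group_add set \<Rightarrow> 'a set \<Rightarrow> 'a set \<Rightarrow> 'a set" where
  "restricted_sumset S A B = {a + b | a b. a \<in> A \<and> b \<in> B \<and> a - b \<notin> S}"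

text \<open>p(G): least prime factor of |G|, for the finite group given by the type 'a
  (meaningful when CARD('a) > 1).\<close>
definition least_prime_factor_grp :: "'a::finite itself \<Rightarrow> nat" where
  "least_prime_factor_grp (t::'a itself) = Min (prime_factors (card (UNIV::'a set)))"

end

theory Submission
  imports Defs "HOL-Computational_Algebra.Polynomial"
begin

text \<open>Over \<open>Z/q\<close> with \<open>q\<close> prime, the polynomial method gives the bound without any size condition: the
  product of \<open>x - y - k\<close> over the forbidden differences and \<open>x + y - c\<close> over the sums vanishes on
  \<open>A \<times> B\<close>, while two consecutive middle coefficients of \<open>(X - 1)\<^sup>s (X + 1)\<^sup>k\<close> cannot both vanish
  modulo \<open>q\<close>.

  A general group is cut into cosets of a subgroup \<open>M\<close> of prime index \<open>q\<close>. The sharp bound in the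
  quotient \<open>Z/q\<close>, applied to each level set of the fibre sizes, is combined with bounds for restricted
  sumsets inside \<open>M\<close>. A first induction, over subgroups and with no size condition, proves the weak
  bound \<open>|A| + |B| - 9|S| + 6\<close>, which for \<open>|S| = 1\<close> is the claim and for empty \<open>S\<close> is replaced by the
  Cauchy-Davenport bound. A second induction proves the claim: with the weak bound for the fibres, the
  condition \<open>|A|, |B| \<ge> 9|S|\<^sup>2 - 5|S| - 3\<close> makes the gain from having at least two fibres outweigh the
  loss caused by the forbidden differences.\<close>

text \<open>The claim cannot be proved by a direct induction, because a fibre may violate the size
  condition although A and B satisfy it; hence the need for an unconditional, if lossy, bound for
  the fibres. A class of differences holding s forbidden ones costs a sum fibre at most s elements,
  so a level t is introduced: once t elements of every fibre of A are given up, classes with at most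
  t forbidden differences are harmless, and only the others are forbidden in Z/q. A small t leaves
  many forbidden classes, a large t is paid for in every fibre. Let \<kappa> be the number of
  classes meeting S. If A and B both meet at least 2\<kappa> + 2 classes, fibres without forbidden
  differences and level 0 suffice. Otherwise one of them, say A, has at most 2\<kappa> + 1 fibres,
  and its largest fibre is wanted above |S| - \<kappa> + 1, the most forbidden differences one class
  can hold. By pigeonhole this takes |A| of the order of (2\<kappa> + 1)(|S| - \<kappa> + 2), hence
  a condition quadratic in |S|. For |S| = 1 the condition reads |A|, |B| \<ge> 1.\<close>

section \<open>Residues modulo a prime: the polynomial method\<close>

text \<open>Up to a common factor these are the Lagrange weights 1 / prod (a - c), with c running
  over the other points: summing against them reads off the coefficient of degree |A| - 1.
  Denominators are cleared so that everything stays in the integers.\<close>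

lemma lagrange_weights:
  fixes A :: "int set" and q :: int
  assumes "finite A" "A \<noteq> {}" "prime q"
    and "\<And>x y. x \<in> A \<Longrightarrow> y \<in> A \<Longrightarrow> x \<noteq> y \<Longrightarrow> \<not> q dvd x - y"
  shows "\<exists>u D. \<not> q dvd D \<and>
    (\<forall>i < card A. (\<Sum>a\<in>A. u a * a ^ i) = (if i = card A - 1 then D else 0))"
  using assms(1,2,4)
proof (induction A rule: finite_ne_induct)
  case (singleton x)
  show ?case
    using \<open>prime q\<close> by (intro exI[of _ "\<lambda>_. 1"] exI[of _ 1]) (auto dest: not_prime_unit)
next
  case (insert z A)
  obtain u D where D: "\<not> q dvd D"
    and u: "\<And>i. i < card A \<Longrightarrow> (\<Sum>a\<in>A. u a * a ^ i) = (if i = card A - 1 then D else 0)"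
  proof -
    have "\<And>x y. x \<in> A \<Longrightarrow> y \<in> A \<Longrightarrow> x \<noteq> y \<Longrightarrow> \<not> q dvd x - y"
      using insert.prems by blast
    from insert.IH[OF this] show ?thesis using that by blast
  qed
  define E where "E = (\<Prod>a\<in>A. a - z)"
  \<comment> \<open>The old weight is divided by a - z, with the denominator cleared by
    \<open>E\<close>. The weight at z then makes the moment of order 0 vanish, and the factor a - z
    of a^i - z^i leads back to the moments over A.\<close>
  define v where "v a = u a * (\<Prod>c\<in>A - {a}. c - z)" for a
  have v: "v a * (a - z) = u a * E" if "a \<in> A" for a
    using prod.remove[OF insert.hyps(1) that, of "\<lambda>c. c - z"] by (simp add: v_def E_def)
  define u' where "u' x = (if x = z then - (\<Sum>a\<in>A. v a) else v x)" for x
  have "\<not> q dvd E"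
  proof
    assume "q dvd E"
    then obtain a where "a \<in> A" "q dvd a - z"
      by (auto simp: E_def prime_dvd_prod_iff[OF insert.hyps(1) \<open>prime q\<close>])
    thus False using insert.prems[of a z] insert.hyps by auto
  qed
  hence D': "\<not> q dvd E * D"
    using D \<open>prime q\<close> prime_dvd_mult_iff by blast
  have "(\<Sum>a\<in>insert z A. u' a * a ^ i) = (if i = card (insert z A) - 1 then E * D else 0)"
    if i: "i < card (insert z A)" for i
  proof -
    have "(\<Sum>a\<in>insert z A. u' a * a ^ i) = (\<Sum>a\<in>A. v a * a ^ i) - (\<Sum>a\<in>A. v a) * z ^ i"
    proof -
      have "(\<Sum>a\<in>A. u' a * a ^ i) = (\<Sum>a\<in>A. v a * a ^ i)"
        using insert.hyps(3) by (intro sum.cong) (auto simp: u'_def)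
      thus ?thesis
        using insert.hyps by (simp add: u'_def)
    qed
    also have "\<dots> = (\<Sum>a\<in>A. v a * (a ^ i - z ^ i))"
      by (simp add: right_diff_distrib sum_subtractf sum_distrib_right)
    also have "\<dots> = (\<Sum>a\<in>A. \<Sum>j<i. E * z ^ (i - Suc j) * (u a * a ^ j))"
    proof (rule sum.cong)
      fix a assume "a \<in> A"
      have "v a * (a ^ i - z ^ i) = (v a * (a - z)) * (\<Sum>j<i. z ^ (i - Suc j) * a ^ j)"
        by (simp only: power_diff_sumr2 mult.assoc)
      thus "v a * (a ^ i - z ^ i) = (\<Sum>j<i. E * z ^ (i - Suc j) * (u a * a ^ j))"
        by (simp only: v[OF \<open>a \<in> A\<close>] sum_distrib_left mult_ac)
    qed simp
    also have "\<dots> = (\<Sum>j<i. E * z ^ (i - Suc j) * (\<Sum>a\<in>A. u a * a ^ j))"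
      by (subst sum.swap) (simp add: sum_distrib_left)
    also have "\<dots> = (\<Sum>j<i. E * z ^ (i - Suc j) * (if j = card A - 1 then D else 0))"
      using i insert.hyps by (intro sum.cong) (simp_all add: u)
    also have "\<dots> = (\<Sum>j<i. if j = card A - 1 then E * z ^ (i - Suc j) * D else 0)"
      by (intro sum.cong) auto
    also have "\<dots> = (if i = card (insert z A) - 1 then E * D else 0)"
      using i insert.hyps by (auto simp: sum.delta card_gt_0_iff)
    finally show ?thesis .
  qed
  hence "\<forall>i<card (insert z A). (\<Sum>a\<in>insert z A. u' a * a ^ i) =
      (if i = card (insert z A) - 1 then E * D else 0)" by simp
  with D' show ?case by (intro exI[of _ u'] exI[of _ "E * D"] conjI)
qed

text \<open>Only the top homogeneous part of the product survives: on monomials of smaller total degree one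
  of the two weighted sums vanishes.\<close>
lemma linear_forms_functional:
  fixes u v :: "int \<Rightarrow> int" and A B :: "int set"
  assumes u: "\<And>i. i \<le> m \<Longrightarrow> (\<Sum>a\<in>A. u a * a ^ i) = (if i = m then D else 0)"
    and v: "\<And>i. i \<le> n \<Longrightarrow> (\<Sum>b\<in>B. v b * b ^ i) = (if i = n then E else 0)"
    and "i + j + length xs \<le> m + n"
  shows "(\<Sum>a\<in>A. \<Sum>b\<in>B. u a * v b * (a ^ i * b ^ j * (\<Prod>(e, c)\<leftarrow>xs. a + e * b - c))) =
    (if i + j + length xs = m + n
     then D * E * coeff (monom 1 i * (\<Prod>(e, c)\<leftarrow>xs. [:e, 1:])) m else 0)"
  using assms(3)
proof (induction xs arbitrary: i j)
  case Nil
  have "(\<Sum>a\<in>A. \<Sum>b\<in>B. u a * v b * (a ^ i * b ^ j)) =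
      (\<Sum>a\<in>A. u a * a ^ i) * (\<Sum>b\<in>B. v b * b ^ j)"
    by (simp add: sum_product mult_ac)
  moreover have "i \<le> m \<or> j < n" using Nil by auto
  ultimately show ?case using Nil
    by (cases "i \<le> m"; cases "j \<le> n") (auto simp: u v)
next
  case (Cons x xs)
  obtain e c where x: "x = (e, c)" by force
  define P where "P a b = (\<Prod>(e, c)\<leftarrow>xs. a + e * b - c)" for a b :: int
  define Q where "Q = (\<Prod>(e, c)\<leftarrow>xs. [:e, 1:])"
  define L where "L F = (\<Sum>a\<in>A. \<Sum>b\<in>B. u a * v b * F a b)" for F
  have IH: "L (\<lambda>a b. a ^ i * b ^ j * P a b) =
     (if i + j + length xs = m + n then D * E * coeff (monom 1 i * Q) m else 0)"
    if "i + j + length xs \<le> m + n" for i j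
    unfolding L_def P_def Q_def using Cons.IH[OF that] .
  have "L (\<lambda>a b. a ^ i * b ^ j * ((a + e * b - c) * P a b)) =
     L (\<lambda>a b. a ^ Suc i * b ^ j * P a b) + e * L (\<lambda>a b. a ^ i * b ^ Suc j * P a b)
       - c * L (\<lambda>a b. a ^ i * b ^ j * P a b)"
    unfolding L_def sum_distrib_left sum.distrib[symmetric] sum_subtractf[symmetric]
    by (intro sum.cong refl) (simp add: algebra_simps)
  also have "\<dots> = (if i + j + length (x # xs) = m + n
      then D * E * (coeff (monom 1 (Suc i) * Q) m + e * coeff (monom 1 i * Q) m) else 0)"
    using Cons.prems IH[of "Suc i" j] IH[of i "Suc j"] IH[of i j]
    by (auto simp: algebra_simps)
  also have "coeff (monom 1 (Suc i) * Q) m + e * coeff (monom 1 i * Q) m =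
      coeff (monom 1 i * ([:e, 1:] * Q)) m"
  proof -
    have "monom 1 i * ([:e, 1:] * Q) = monom 1 (Suc i) * Q + smult e (monom 1 i * Q)"
      by (simp add: monom_Suc algebra_simps)
    thus ?thesis by simp
  qed
  finally show ?case
    by (simp add: x L_def P_def Q_def)
qed

section \<open>Restricted sumsets modulo q and the coefficient that controls them\<close>

definition rsum :: "nat \<Rightarrow> int set \<Rightarrow> int set \<Rightarrow> int set \<Rightarrow> int set" where
  "rsum q K I J = {(i + j) mod int q | i j. i \<in> I \<and> j \<in> J \<and> (i - j) mod int q \<notin> K}"

lemma rsum_subset: "q > 0 \<Longrightarrow> rsum q K I J \<subseteq> {0..<int q}"
  by (auto simp: rsum_def)

lemma finite_rsum: "q > 0 \<Longrightarrow> finite (rsum q K I J)"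
  by (rule finite_subset[OF rsum_subset]) simp_all

lemma rsum_mono: "I \<subseteq> I' \<Longrightarrow> J \<subseteq> J' \<Longrightarrow> rsum q K I J \<subseteq> rsum q K I' J'"
  by (auto simp: rsum_def)

lemma residues_not_dvd_diff:
  fixes x y :: int
  assumes "x \<in> {0..<int q}" "y \<in> {0..<int q}" "x \<noteq> y"
  shows "\<not> int q dvd x - y"
  using assms by (auto simp: mod_eq_dvd_iff[symmetric])

text \<open>Combinatorial Nullstellensatz: with at most k sums, the product of |K| forms x - y - c
  and k forms x + y - c would vanish modulo q on I x J, while its weighted sum is D * E times the
  given coefficient, three factors prime to q.\<close>

lemma card_rsum_gt:
  assumes q: "prime q" and IJ: "I \<subseteq> {0..<int q}" "J \<subseteq> {0..<int q}" "I \<noteq> {}" "J \<noteq> {}"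
    and K: "finite K" "card K + k + 2 = card I + card J"
    and nd: "\<not> int q dvd coeff ([:-1, 1:] ^ card K * [:1, 1:] ^ k) (card I - 1)"
  shows "card (rsum q K I J) > k"
proof (rule ccontr)
  assume "\<not> k < card (rsum q K I J)"
  define R where "R = rsum q K I J"
  have R: "finite R" "card R \<le> k"
    using \<open>\<not> k < _\<close> finite_rsum prime_gt_0_nat[OF q] by (auto simp: R_def)
  have fin: "finite I" "finite J" using IJ by (meson finite_subset finite_atLeastLessThan_int)+
  have q': "prime (int q)" using q by simp
  have cpos: "card I > 0" "card J > 0" using fin IJ by (auto simp: card_gt_0_iff)
  obtain u D where D: "\<not> int q dvd D"
    and u: "\<And>i. i < card I \<Longrightarrow> (\<Sum>a\<in>I. u a * a ^ i) = (if i = card I - 1 then D else 0)"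
  proof -
    have "\<And>x y. x \<in> I \<Longrightarrow> y \<in> I \<Longrightarrow> x \<noteq> y \<Longrightarrow> \<not> int q dvd x - y"
      using residues_not_dvd_diff IJ(1) by blast
    from lagrange_weights[OF fin(1) IJ(3) q' this] show ?thesis using that by blast
  qed
  obtain v E where E: "\<not> int q dvd E"
    and v: "\<And>i. i < card J \<Longrightarrow> (\<Sum>a\<in>J. v a * a ^ i) = (if i = card J - 1 then E else 0)"
  proof -
    have "\<And>x y. x \<in> J \<Longrightarrow> y \<in> J \<Longrightarrow> x \<noteq> y \<Longrightarrow> \<not> int q dvd x - y"
      using residues_not_dvd_diff IJ(2) by blast
    from lagrange_weights[OF fin(2) IJ(4) q' this] show ?thesis using that by blast
  qed
  obtain ks where ks: "set ks = K" "length ks = card K"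
    using K(1) by (metis distinct_card finite_distinct_list)
  obtain rs where rs: "set rs = R" "length rs = card R"
    using R(1) by (metis distinct_card finite_distinct_list)
  \<comment> \<open>The repeated pair (1, 0), an extra factor x + y, pads the degree to exactly |I|
    + |J| - 2.\<close>
  define xs :: "(int \<times> int) list" where
    "xs = map (Pair (-1)) ks @ map (Pair 1) rs @ replicate (k - card R) (1, 0)"
  have len: "length xs = (card I - 1) + (card J - 1)"
    using ks rs R K cpos by (simp add: xs_def)
  have "(\<Sum>a\<in>I. \<Sum>b\<in>J. u a * v b * (a ^ 0 * b ^ 0 * (\<Prod>(e, c)\<leftarrow>xs. a + e * b - c))) =
      D * E * coeff (monom 1 0 * (\<Prod>(e, c)\<leftarrow>xs. [:e, 1:])) (card I - 1)"
    using linear_forms_functional[where u=u and v=v and A=I and B=J and m="card I - 1"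
        and n="card J - 1" and D=D and E=E and i=0 and j=0 and xs=xs]
      u v len cpos by simp
  moreover have "(\<Prod>(e, c)\<leftarrow>xs. [:e, 1:]) = [:-1, 1:] ^ card K * [:1, 1:] ^ k"
  proof -
    have "(\<Prod>(e, c)\<leftarrow>xs. [:e, 1:]) =
        [:-1, 1:] ^ card K * ([:1, 1:] ^ card R * [:1, 1:] ^ (k - card R))"
      using ks rs by (simp add: xs_def o_def prod_list_replicate map_replicate_const)
    thus ?thesis using R(2) by (simp flip: power_add)
  qed
  moreover
  have *: "int q dvd (\<Prod>(e, c)\<leftarrow>xs. a + e * b - c)" if "a \<in> I" "b \<in> J" for a b
  proof (cases "(a - b) mod int q \<in> K")
    case True
    hence "(-1, (a - b) mod int q) \<in> set xs" using ks by (auto simp: xs_def)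
    hence "(a + (-1) * b - (a - b) mod int q) dvd (\<Prod>(e, c)\<leftarrow>xs. a + e * b - c)"
      by (intro prod_list_dvd) force
    moreover have "int q dvd (a + (-1) * b - (a - b) mod int q)"
      by (simp add: dvd_minus_mod)
    ultimately show ?thesis using dvd_trans by blast
  next
    case False
    hence "(a + b) mod int q \<in> R" using that by (auto simp: R_def rsum_def)
    hence "(1, (a + b) mod int q) \<in> set xs" using rs by (auto simp: xs_def)
    hence "(a + 1 * b - (a + b) mod int q) dvd (\<Prod>(e, c)\<leftarrow>xs. a + e * b - c)"
      by (intro prod_list_dvd) force
    moreover have "int q dvd (a + 1 * b - (a + b) mod int q)"
      by (simp add: dvd_minus_mod)
    ultimately show ?thesis using dvd_trans by blast
  qed
  have "int q dvd
      (\<Sum>a\<in>I. \<Sum>b\<in>J. u a * v b * (a ^ 0 * b ^ 0 * (\<Prod>(e, c)\<leftarrow>xs. a + e * b - c)))"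
    by (intro dvd_sum dvd_mult *)
  ultimately have "int q dvd D * E * coeff ([:-1, 1:] ^ card K * [:1, 1:] ^ k) (card I - 1)"
    by (simp add: monom_0)
  thus False using D E nd q' prime_dvd_mult_iff by blast
qed

text \<open>Comes from \<open>(X\<^sup>2 - 1) g' = ((s + k) X + (s - k)) g\<close>.\<close>
lemma coeff_recurrence:
  fixes s k i :: nat
  defines "g \<equiv> [:-1, 1:] ^ s * [:1, 1:] ^ k :: int poly"
  shows "(int i + 2) * coeff g (i + 2) =
    (int i - int (s + k)) * coeff g i - (int s - int k) * coeff g (i + 1)"
proof -
  define A B :: "int poly" where "A = [:-1, 1:]" and "B = [:1, 1:]"
  have "A * pderiv (A ^ s) = smult (int s) (A ^ s)"
    by (cases s) (simp_all add: pderiv_power_Suc A_def pderiv_pCons mult.commute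
        del: mult_pCons_left mult_pCons_right power_Suc, simp add: mult.commute)
  moreover have "B * pderiv (B ^ k) = smult (int k) (B ^ k)"
    by (cases k) (simp_all add: pderiv_power_Suc B_def pderiv_pCons mult.commute
        del: mult_pCons_left mult_pCons_right power_Suc, simp add: mult.commute)
  moreover have "A * B * pderiv g =
      (A * pderiv (A ^ s)) * (B * B ^ k) + (A * A ^ s) * (B * pderiv (B ^ k))"
    unfolding g_def pderiv_mult A_def[symmetric] B_def[symmetric] by (simp only: algebra_simps)
  ultimately have "A * B * pderiv g = smult (int s) (B * g) + smult (int k) (A * g)"
    by (simp add: g_def A_def[symmetric] B_def[symmetric] mult_ac)
  moreover have "A * B = [:-1, 0, 1:]"
    by (simp add: A_def B_def)
  ultimately have "coeff ([:-1, 0, 1:] * pderiv g) (Suc i) =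
      coeff (smult (int s) ([:1, 1:] * g) + smult (int k) ([:-1, 1:] * g)) (Suc i)"
    by (simp only: A_def B_def)
  moreover have "coeff ([:-1, 0, 1:] * pderiv g) (Suc i) =
      int i * coeff g i - (int i + 2) * coeff g (i + 2)"
    by (cases i) (simp_all add: coeff_pderiv coeff_pCons)
  moreover have "coeff (smult (int s) ([:1, 1:] * g) + smult (int k) ([:-1, 1:] * g)) (Suc i) =
      int s * (coeff g (i + 1) + coeff g i) + int k * (coeff g i - coeff g (i + 1))"
    by simp
  ultimately show ?thesis by (simp add: algebra_simps)
qed

text \<open>The recurrence has order two, so two consecutive zeros spread in both directions as long
  as division is possible: upwards by i + 2, downwards by s + k - i. Both are units modulo q in the
  window s + k - q < i < q.\<close>

lemma coeff_propagate:
  fixes s k q j i :: nat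
  defines "g \<equiv> [:-1, 1:] ^ s * [:1, 1:] ^ k :: int poly"
  assumes q: "prime q" and j: "int q dvd coeff g j" "int q dvd coeff g (j + 1)"
    and jq: "j + 1 < q" "s + k < j + q" "j < s + k"
    and i: "i < q" "s + k < i + q"
  shows "int q dvd coeff g i"
proof -
  have q': "prime (int q)" using q by simp
  have cancel: "int q dvd x" if "int q dvd c * x" "\<not> int q dvd c" for c x
    using that q' prime_dvd_mult_iff by blast
  have up: "int q dvd coeff g (j + n) \<and> int q dvd coeff g (j + n + 1)" if "j + n + 1 < q" for n
    using that
  proof (induction n)
    case (Suc n)
    define t where "t = j + n"
    have IH: "int q dvd coeff g t" "int q dvd coeff g (t + 1)" using Suc by (auto simp: t_def)
    have "int q dvd (int t + 2) * coeff g (t + 2)"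
      unfolding g_def coeff_recurrence
      using IH by (intro dvd_diff dvd_mult) (simp_all add: g_def)
    moreover have "\<not> int q dvd int t + 2"
      using Suc.prems by (auto simp: t_def dest!: zdvd_imp_le)
    ultimately have "int q dvd coeff g (t + 2)" by (rule cancel)
    thus ?case using IH by (simp add: t_def)
  qed (use j in simp)
  have down: "int q dvd coeff g (j - n) \<and> int q dvd coeff g (j - n + 1)"
    if "n \<le> j" "s + k < j - n + q" for n
    using that
  proof (induction n)
    case (Suc n)
    define t where "t = j - Suc n"
    have t: "j - n = t + 1" using Suc.prems by (simp add: t_def)
    have IH: "int q dvd coeff g (t + 1)" "int q dvd coeff g (t + 2)"
      using Suc t by (auto simp: t_def)
    have "(int (s + k) - int t) * coeff g t =
        - ((int t + 2) * coeff g (t + 2) + (int s - int k) * coeff g (t + 1))"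
      using coeff_recurrence[of t s k] by (simp add: g_def algebra_simps)
    hence "int q dvd (int (s + k) - int t) * coeff g t"
      using IH by simp
    moreover have "\<not> int q dvd int (s + k) - int t"
      using Suc.prems jq by (auto simp: t_def dest!: zdvd_imp_le)
    ultimately have "int q dvd coeff g t" by (rule cancel)
    thus ?case using IH by (simp add: t_def)
  qed (use j in simp)
  show ?thesis
  proof (cases "i \<le> j")
    case True
    thus ?thesis using down[of "j - i"] i by simp
  next
    case False
    thus ?thesis using up[of "i - j - 1"] i by simp
  qed
qed

lemma poly_one_eq_sum_coeff:
  fixes p :: "'a::comm_semiring_1 poly"
  assumes "degree p < n"
  shows "poly p 1 = (\<Sum>i<n. coeff p i)"
proof -
  have "poly p 1 = (\<Sum>i\<le>degree p. coeff p i)" by (simp add: poly_altdef)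
  also have "\<dots> = (\<Sum>i<n. coeff p i)"
    using assms by (intro sum.mono_neutral_left) (auto simp: coeff_eq_0)
  finally show ?thesis .
qed

text \<open>Modulo q the factor (X - 1)^q is X^q - 1, so below degree q it acts as multiplication by
  -1.\<close>

lemma coeff_pow_minus_one_mult_cong:
  fixes Q :: "int poly"
  assumes q: "prime q" "odd q" and i: "i < q"
  shows "int q dvd coeff ([:-1, 1:] ^ q * Q) i + coeff Q i"
proof -
  have 1: "coeff ([:-1, 1:] ^ q :: int poly) r = int (q choose r) * (-1) ^ (q - r)" if "r \<le> q" for r
    using coeff_linear_poly_power[OF that, of "-1::int" 1] by simp
  have "coeff ([:-1, 1:] ^ q * Q) i = (\<Sum>r\<le>i. coeff ([:-1, 1:] ^ q) r * coeff Q (i - r))"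
    by (simp add: coeff_mult)
  also have "\<dots> = (\<Sum>r\<in>{..i} - {0}. coeff ([:-1, 1:] ^ q) r * coeff Q (i - r)) - coeff Q i"
    using q by (subst sum.remove[of _ 0]) (auto simp: coeff_0_power)
  finally have "coeff ([:-1, 1:] ^ q * Q) i + coeff Q i =
      (\<Sum>r\<in>{..i} - {0}. coeff ([:-1, 1:] ^ q) r * coeff Q (i - r))" by simp
  moreover have "int q dvd coeff ([:-1, 1:] ^ q) r" if "r \<in> {..i} - {0}" for r
    using that i q by (auto simp: 1 intro!: dvd_mult2 dvd_choose_prime)
  ultimately show ?thesis
    by (metis (no_types, lifting) dvd_mult2 dvd_sum)
qed

text \<open>Otherwise the recurrence kills every coefficient with index between \<open>s + k - q\<close> and \<open>q\<close>. Multiply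
  by \<open>(X - 1)\<close> to the power \<open>q - s\<close>: modulo \<open>q\<close> and \<open>X\<^sup>q\<close> this turns \<open>g\<close> into \<open>- (X + 1)\<^sup>k\<close>, whereas the
  remaining low part of \<open>g\<close> becomes a polynomial vanishing at 1.\<close>
lemma no_two_consecutive_zero_coeffs:
  fixes s k q j :: nat
  defines "g \<equiv> [:-1, 1:] ^ s * [:1, 1:] ^ k :: int poly"
  assumes q: "prime q" "odd q" and sk: "s < q" "k < q"
    and jq: "j + 1 < q" "s + k < j + q" "j < s + k"
  shows "\<not> (int q dvd coeff g j \<and> int q dvd coeff g (j + 1))"
proof
  assume j: "int q dvd coeff g j \<and> int q dvd coeff g (j + 1)"
  have small: "int q dvd coeff g i" if "i < q" "s + k < i + q" for i
    using coeff_propagate[OF q(1), of s k j i] j jq that by (simp add: g_def)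
  define B :: "int poly" where "B = [:1, 1:] ^ k"
  define C :: "int poly" where "C = [:-1, 1:] ^ (q - s)"
  \<comment> \<open>The part of \<open>g\<close> below the window, of degree at most s + k - q;
    truncated subtraction makes it 0 when s + k < q.\<close>
  define L where "L = poly_cutoff (s + k + 1 - q) g"
  have degB: "degree B = k" by (simp add: B_def degree_linear_power)
  have degC: "degree C = q - s" by (simp add: C_def degree_linear_power)
  have Cg: "C * g = [:-1, 1:] ^ q * B"
    using sk unfolding C_def g_def B_def mult.assoc[symmetric] power_add[symmetric] by simp
  have coeff_L: "coeff L i = (if i + q \<le> s + k then coeff g i else 0)" for i
    by (auto simp: L_def coeff_poly_cutoff)
  have degCL: "degree (C * L) < q"
  proof (cases "L = 0")
    case True
    thus ?thesis using q prime_gt_0_nat by auto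
  next
    case False
    have "degree L + q \<le> s + k"
      using False coeff_L[of "degree L"] by (metis leading_coeff_neq_0)
    thus ?thesis using degree_mult_le[of C L] degC sk by linarith
  qed
  have "int q dvd (\<Sum>i<q. coeff (C * L) i + coeff B i)"
  proof (rule dvd_sum)
    fix i assume "i \<in> {..<q}"
    hence i: "i < q" by simp
    have "coeff (C * g) i - coeff (C * L) i = (\<Sum>r\<le>i. coeff C r * (coeff g (i - r) - coeff L (i - r)))"
      by (simp add: coeff_mult sum_subtractf right_diff_distrib)
    moreover have "int q dvd coeff C r * (coeff g (i - r) - coeff L (i - r))" for r
      using small[of "i - r"] i by (auto simp: coeff_L)
    ultimately have "int q dvd coeff (C * g) i - coeff (C * L) i"
      by (simp add: dvd_sum)
    moreover have "int q dvd coeff (C * g) i + coeff B i"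
      using coeff_pow_minus_one_mult_cong[OF q i] by (simp add: Cg)
    ultimately have "int q dvd (coeff (C * g) i + coeff B i) - (coeff (C * g) i - coeff (C * L) i)"
      by (rule dvd_diff[rotated])
    thus "int q dvd coeff (C * L) i + coeff B i" by (simp add: algebra_simps)
  qed
  \<comment> \<open>Evaluation at 1: \<open>C\<close> has a zero there because s < q, and
    \<open>B\<close> takes the value 2^k, a unit modulo the odd prime q.\<close>
  also have "(\<Sum>i<q. coeff (C * L) i + coeff B i) = poly (C * L) 1 + poly B 1"
    using degCL degB sk by (simp add: sum.distrib poly_one_eq_sum_coeff del: poly_mult)
  also have "\<dots> = int (2 ^ k)"
    using sk by (simp add: C_def B_def power_0_left)
  finally have "q dvd 2 ^ k" by (simp only: int_dvd_int_iff)
  hence "q dvd 2" using q(1) prime_dvd_power_nat by blast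
  hence "q = 2" using q(1) by (simp add: primes_dvd_imp_eq)
  thus False using q by simp
qed

section \<open>The sharp bound in Z/q\<close>

lemma row_rsum:
  assumes q: "q > 0" and IJ: "J \<subseteq> {0..<int q}" "i \<in> {0..<int q}" and K: "finite K"
  shows "card (rsum q K {i} J) + card K \<ge> card J"
proof -
  have fin: "finite J" using IJ by (meson finite_subset finite_atLeastLessThan_int)
  define J' where "J' = {j \<in> J. (i - j) mod int q \<notin> K}"
  have inj: "inj_on (\<lambda>j. (i - j) mod int q) J"
  proof (rule inj_onI)
    fix x y assume *: "x \<in> J" "y \<in> J" "(i - x) mod int q = (i - y) mod int q"
    hence "int q dvd (i - x) - (i - y)" by (simp add: mod_eq_dvd_iff)
    hence "int q dvd y - x" by simp
    thus "x = y" using * IJ residues_not_dvd_diff by blast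
  qed
  have inj': "inj_on (\<lambda>j. (i + j) mod int q) J'"
  proof (rule inj_onI)
    fix x y assume *: "x \<in> J'" "y \<in> J'" "(i + x) mod int q = (i + y) mod int q"
    hence "int q dvd (i + x) - (i + y)" by (simp add: mod_eq_dvd_iff)
    hence "int q dvd x - y" by simp
    moreover have "x \<in> {0..<int q}" "y \<in> {0..<int q}" using * IJ by (auto simp: J'_def)
    ultimately show "x = y" using residues_not_dvd_diff by blast
  qed
  have "card (J - J') \<le> card K"
    using K by (intro card_inj_on_le[OF inj_on_subset[OF inj]]) (auto simp: J'_def)
  moreover have "card J' \<le> card (rsum q K {i} J)"
    by (rule card_inj_on_le[OF inj' _ finite_rsum[OF q]]) (auto simp: J'_def rsum_def)
  moreover have "card J = card J' + card (J - J')"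
    using fin by (subst card_Un_disjoint[symmetric]) (auto simp: J'_def intro!: arg_cong[of _ _ card])
  ultimately show ?thesis by linarith
qed

lemma column_rsum:
  assumes q: "q > 0" and IJ: "I \<subseteq> {0..<int q}" "j \<in> {0..<int q}" and K: "finite K"
  shows "card (rsum q K I {j}) + card K \<ge> card I"
proof -
  \<comment> \<open>Exchanging the two arguments negates differences; \<open>K\<close> may contain
    integers that are not residues, so only its part in 0..<q is reflected.\<close>
  have "rsum q K I {j} = rsum q ((\<lambda>k. (- k) mod int q) ` (K \<inter> {0..<int q})) {j} I"
  proof -
    have "(i - j) mod int q \<in> K \<longleftrightarrow> (j - i) mod int q \<in> (\<lambda>k. (- k) mod int q) ` (K \<inter> {0..<int q})" for i
    proof
      assume "(i - j) mod int q \<in> K"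
      moreover have "(j - i) mod int q = (- ((i - j) mod int q)) mod int q"
        by (simp add: mod_minus_eq)
      ultimately show "(j - i) mod int q \<in> (\<lambda>k. (- k) mod int q) ` (K \<inter> {0..<int q})"
        using q by auto
    next
      assume "(j - i) mod int q \<in> (\<lambda>k. (- k) mod int q) ` (K \<inter> {0..<int q})"
      then obtain k where k: "k \<in> K" "0 \<le> k" "k < int q" "(j - i) mod int q = (- k) mod int q"
        by auto
      have "(i - j) mod int q = (- ((j - i) mod int q)) mod int q"
        by (simp add: mod_minus_eq)
      also have "\<dots> = k" using k by (simp add: mod_minus_eq)
      finally show "(i - j) mod int q \<in> K" using k by simp
    qed
    thus ?thesis by (auto simp: rsum_def add.commute)
  qed
  moreover have "card ((\<lambda>k. (- k) mod int q) ` (K \<inter> {0..<int q})) \<le> card K"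
    using K card_image_le[of "K \<inter> {0..<int q}" "\<lambda>k. (- k) mod int q"] card_mono[of K "K \<inter> {0..<int q}"]
    by auto
  ultimately show ?thesis
    using row_rsum[OF q IJ, of "(\<lambda>k. (- k) mod int q) ` (K \<inter> {0..<int q})"] K by simp
qed

text \<open>For empty \<open>K\<close> this is Cauchy-Davenport, decided by a binomial coefficient.
  For non-empty \<open>K\<close> a single coefficient of (X - 1)^|K| (X + 1)^k may vanish modulo q,
  so one element is sacrificed: dropping it from I or from J asks for one of two neighbouring
  coefficients, and one of them survives. This is the extra loss of 1.\<close>

theorem card_rsum_ge:
  assumes q: "prime q" and IJ: "I \<subseteq> {0..<int q}" "J \<subseteq> {0..<int q}" "I \<noteq> {}" "J \<noteq> {}"
    and K: "finite K" "card K < q"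
  shows "int (card (rsum q K I J)) \<ge>
    min (int q) (int (card I) + int (card J) - 1 - (if K = {} then 0 else int (card K) + 1))"
proof -
  have q0: "q > 0" using q prime_gt_0_nat by blast
  have fin: "finite I" "finite J" using IJ by (meson finite_subset finite_atLeastLessThan_int)+
  have le: "card I \<le> q" "card J \<le> q"
    using IJ card_mono[of "{0..<int q}"] by auto
  have pos: "card I \<ge> 1" "card J \<ge> 1"
    using fin IJ by (auto simp: Suc_le_eq card_gt_0_iff)
  have "card (rsum q K {i} J) \<le> card (rsum q K I J)" if "i \<in> I" for i
    using that finite_rsum[OF q0] by (intro card_mono rsum_mono) auto
  hence row: "card (rsum q K I J) + card K \<ge> card J"
    using row_rsum[OF q0 IJ(2) _ K(1)] IJ(1,3) by fastforce
  have "card (rsum q K I {j}) \<le> card (rsum q K I J)" if "j \<in> J" for j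
    using that finite_rsum[OF q0] by (intro card_mono rsum_mono) auto
  hence col: "card (rsum q K I J) + card K \<ge> card I"
    using column_rsum[OF q0 IJ(1) _ K(1)] IJ(2,4) by fastforce
  show ?thesis
  proof (cases "K = {}")
    case True
    show ?thesis
    proof (rule ccontr)
      assume *: "\<not> ?thesis"
      \<comment> \<open>Shrinking I keeps k below q, where the binomial coefficient is prime to
        q.\<close>
      define m where "m = min (card I) (q + 1 - card J)"
      have m: "1 \<le> m" "m \<le> card I" using pos le by (auto simp: m_def)
      obtain I' where I': "I' \<subseteq> I" "card I' = m"
        using m fin obtain_subset_with_card_n by blast
      define k where "k = m + card J - 2"
      have "m + card J - 2 < q" using le q0 prime_gt_1_nat[OF q] by (auto simp: m_def)
      have "\<not> q dvd (k choose (m - 1))"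
      proof
        assume "q dvd (k choose (m - 1))"
        moreover have "m - 1 \<le> k" using m pos by (simp add: k_def)
        ultimately have "q dvd fact k"
          using binomial_fact_lemma[of "m - 1" k] by (metis dvd_mult)
        thus False using prime_dvd_fact_iff q \<open>m + card J - 2 < q\<close> by (simp add: k_def)
      qed
      moreover have "coeff ([:1, 1:] ^ k :: int poly) (m - 1) = int (k choose (m - 1))"
        using m pos by (subst coeff_linear_poly_power) (auto simp: k_def)
      ultimately have "k < card (rsum q K I' J)"
        using I' IJ m pos True fin
        by (intro card_rsum_gt[OF q]) (auto simp: k_def)
      also have "\<dots> \<le> card (rsum q K I J)"
        using I' finite_rsum[OF q0] by (intro card_mono rsum_mono) auto
      finally show False using * True m pos le by (auto simp: k_def m_def split: if_splits)
    qed
  next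
    case False
    hence kap: "card K \<ge> 1" using K by (simp add: Suc_le_eq card_gt_0_iff)
    show ?thesis
    proof (rule ccontr)
      assume *: "\<not> ?thesis"
      define m where "m = min (card I) (q + 2 + card K - card J)"
      \<comment> \<open>If |I| \<le> 2 or |J| \<le> 2, a single row or column already reaches the
        bound.\<close>
      have big: "card I \<ge> 3" "card J \<ge> 3"
        using * row col False by (auto split: if_splits)
      have m: "3 \<le> m" "m \<le> card I" using big le kap by (auto simp: m_def)
      obtain I' where I': "I' \<subseteq> I" "card I' = m"
        using m fin obtain_subset_with_card_n by blast
      have mono: "card (rsum q K I0 J0) \<le> card (rsum q K I J)" if "I0 \<subseteq> I" "J0 \<subseteq> J" for I0 J0
        using that finite_rsum[OF q0] by (intro card_mono rsum_mono) auto
      \<comment> \<open>The degree |K| + k is one short of m + |J| - 2, which leaves room for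
        dropping one element.\<close>
      define k where "k = m + card J - 3 - card K"
      have k: "k + card K + 3 = m + card J" "k < q" "card (rsum q K I J) \<le> k"
        using * False le big kap m by (auto simp: k_def m_def split: if_splits)
      have "q \<noteq> 2" using big le by auto
      hence "odd q" using q primes_dvd_imp_eq two_is_prime_nat by blast
      hence "\<not> (int q dvd coeff ([:-1, 1:] ^ card K * [:1, 1:] ^ k) (m - 2) \<and>
                int q dvd coeff ([:-1, 1:] ^ card K * [:1, 1:] ^ k) (m - 2 + 1))"
        using q K k m big le by (intro no_two_consecutive_zero_coeffs) auto
      then consider "\<not> int q dvd coeff ([:-1, 1:] ^ card K * [:1, 1:] ^ k) (m - 2)"
        | "\<not> int q dvd coeff ([:-1, 1:] ^ card K * [:1, 1:] ^ k) (m - 1)"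
        using m by (auto simp: Suc_diff_Suc numeral_2_eq_2)
      thus False
      proof cases
        case 1
        obtain I'' where I'': "I'' \<subseteq> I'" "card I'' = m - 1"
          using I' obtain_subset_with_card_n by (metis diff_le_self)
        have "k < card (rsum q K I'' J)"
          using I'' I' IJ m 1 K k by (intro card_rsum_gt[OF q]) (auto simp: numeral_2_eq_2)
        thus False using mono[of I'' J] I' I'' k by auto
      next
        case 2
        obtain J'' where J'': "J'' \<subseteq> J" "card J'' = card J - 1"
          using obtain_subset_with_card_n by (metis diff_le_self)
        have "k < card (rsum q K I' J'')"
          using J'' I' IJ m 2 K k big by (intro card_rsum_gt[OF q]) auto
        thus False using mono[of I' J''] I' J'' k by auto
      qed
    qed
  qed
qed

section \<open>Cutting a sumset into fibres over a prime quotient\<close>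

definition weak_loss :: "nat \<Rightarrow> int" where
  "weak_loss s = (if s = 0 then 1 else 9 * int s - 6)"

definition size_threshold :: "nat \<Rightarrow> int" where
  "size_threshold s = 9 * int s ^ 2 - 5 * int s - 3"

lemma sum_ge_layers:
  fixes f :: "'a \<Rightarrow> nat"
  assumes "finite L"
  shows "(\<Sum>h\<in>{1..N}. card {l \<in> L. h \<le> f l}) \<le> (\<Sum>l\<in>L. f l)"
proof -
  have "(\<Sum>h\<in>{1..N}. card {l \<in> L. h \<le> f l}) = (\<Sum>h\<in>{1..N}. \<Sum>l\<in>L. if h \<le> f l then 1 else 0)"
    using assms by (simp add: sum.If_cases Int_def)
  also have "\<dots> = (\<Sum>l\<in>L. \<Sum>h\<in>{1..N}. if h \<le> f l then 1 else 0)"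
    by (rule sum.swap)
  also have "\<dots> \<le> (\<Sum>l\<in>L. f l)"
  proof (rule sum_mono)
    fix l
    have "{h \<in> {1..N}. h \<le> f l} \<subseteq> {1..f l}" by auto
    hence "card {h \<in> {1..N}. h \<le> f l} \<le> f l"
      using card_mono[of "{1..f l}"] by fastforce
    thus "(\<Sum>h\<in>{1..N}. if h \<le> f l then 1 else 0) \<le> f l"
      by (simp add: sum.If_cases Int_def)
  qed
  finally show ?thesis .
qed

text \<open>Layer-cake summation above height t; the truncated difference lets fibres of size at
  most t contribute 0.\<close>

lemma sum_layers_above:
  fixes a :: "'a \<Rightarrow> nat"
  assumes "finite I" "\<And>i. i \<in> I \<Longrightarrow> a i \<le> N"
  shows "(\<Sum>h\<in>{1..N - t}. card {i \<in> I. h + t \<le> a i}) = (\<Sum>i\<in>I. a i - t)"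
proof -
  have "(\<Sum>h\<in>{1..N - t}. card {i \<in> I. h + t \<le> a i}) =
      (\<Sum>h\<in>{1..N - t}. \<Sum>i\<in>I. if h + t \<le> a i then 1 else 0)"
    using assms by (simp add: sum.If_cases Int_def)
  also have "\<dots> = (\<Sum>i\<in>I. \<Sum>h\<in>{1..N - t}. if h + t \<le> a i then 1 else 0)"
    by (rule sum.swap)
  also have "\<dots> = (\<Sum>i\<in>I. a i - t)"
  proof (rule sum.cong)
    fix i assume "i \<in> I"
    hence "{h \<in> {1..N - t}. h + t \<le> a i} = {1..a i - t}"
      using assms(2)[of i] by auto
    thus "(\<Sum>h\<in>{1..N - t}. if h + t \<le> a i then 1 else 0) = a i - t"
      by (simp add: sum.If_cases Int_def)
  qed simp
  finally show ?thesis .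
qed

text \<open>The fibre sizes of \<open>A\<close>, \<open>B\<close>, \<open>S\<close> and of the restricted sumset over the residue classes modulo \<open>q\<close>,
  in the situation of a counterexample, where the restricted sumset has fewer than \<open>p\<close> elements.\<close>
locale fibration =
  fixes q p :: nat and a b s f :: "int \<Rightarrow> nat"
  assumes q: "prime q" and pq: "p \<le> q"
    and total_less: "(\<Sum>l\<in>{0..<int q}. f l) < p"
    and K_less: "card {k \<in> {0..<int q}. s k > 0} < q"
    and I_ne: "{i \<in> {0..<int q}. a i > 0} \<noteq> {}"
    and J_ne: "{j \<in> {0..<int q}. b j > 0} \<noteq> {}"
    and fib_a: "\<And>i j. i \<in> {0..<int q} \<Longrightarrow> j \<in> {0..<int q} \<Longrightarrow> a i > 0 \<Longrightarrow> b j > 0 \<Longrightarrow>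
      a i \<le> f ((i + j) mod int q) + s ((i - j) mod int q)"
    and fib_b: "\<And>i j. i \<in> {0..<int q} \<Longrightarrow> j \<in> {0..<int q} \<Longrightarrow> a i > 0 \<Longrightarrow> b j > 0 \<Longrightarrow>
      b j \<le> f ((i + j) mod int q) + s ((i - j) mod int q)"
    and fib_weak: "\<And>i j. i \<in> {0..<int q} \<Longrightarrow> j \<in> {0..<int q} \<Longrightarrow> a i > 0 \<Longrightarrow> b j > 0 \<Longrightarrow>
      int (a i) + int (b j) \<le> int (f ((i + j) mod int q)) + weak_loss (s ((i - j) mod int q))"
begin

definition "Q = {0..<int q}"
definition "I = {i \<in> Q. a i > 0}"
definition "J = {j \<in> Q. b j > 0}"
text \<open>The classes of differences still forbidden after t elements of every fibre are given
  up.\<close>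

definition "K t = {k \<in> Q. s k > t}"
text \<open>What forbidding \<open>K t\<close> costs in Z/q beyond Cauchy-Davenport, as in
  \<open>card_rsum_ge\<close>.\<close>

definition "lam t = (if K t = {} then 0 else int (card (K t)) + 1)"

abbreviation "m \<equiv> int (card I)"
abbreviation "n \<equiv> int (card J)"
abbreviation "\<kappa> \<equiv> int (card (K 0))"
abbreviation "A \<equiv> \<Sum>x\<in>Q. int (a x)"
abbreviation "B \<equiv> \<Sum>x\<in>Q. int (b x)"
abbreviation "S \<equiv> \<Sum>x\<in>Q. int (s x)"
abbreviation "F \<equiv> \<Sum>x\<in>Q. int (f x)"

lemma q_pos: "q > 0"
  using q prime_gt_0_nat by blast

lemma finite_Q [simp]: "finite Q"
  by (simp add: Q_def)

lemma finites [simp]: "finite I" "finite J" "finite (K t)"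
  by (simp_all add: I_def J_def K_def)

lemma subsets: "I \<subseteq> Q" "J \<subseteq> Q" "K t \<subseteq> Q"
  by (auto simp: I_def J_def K_def)

lemma mod_in_Q [simp]: "x mod int q \<in> Q"
  using q_pos by (simp add: Q_def)

lemma sum_I: "(\<Sum>i\<in>I. int (a i)) = A"
  by (rule sum.mono_neutral_left) (auto simp: I_def)

lemma sum_J: "(\<Sum>j\<in>J. int (b j)) = B"
  by (rule sum.mono_neutral_left) (auto simp: J_def)

lemma sum_K: "(\<Sum>k\<in>K 0. int (s k)) = S"
  by (rule sum.mono_neutral_left) (auto simp: K_def)

lemma m_pos: "m \<ge> 1" and n_pos: "n \<ge> 1"
  using I_ne J_ne card_gt_0_iff[of I] card_gt_0_iff[of J]
  by (auto simp: I_def[unfolded Q_def] J_def[unfolded Q_def] simp flip: Q_def)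

lemma F_less: "F < int p" "F < int q"
  using total_less pq by (simp_all add: Q_def flip: of_nat_sum)

lemma kappa_le: "\<kappa> \<le> S"
proof -
  have "(\<Sum>k\<in>K 0. 1) \<le> (\<Sum>k\<in>K 0. int (s k))"
    by (rule sum_mono) (auto simp: K_def)
  thus ?thesis by (simp add: sum_K)
qed

lemma inj_diff: "inj_on (\<lambda>j. (i - j) mod int q) Q"
proof (rule inj_onI)
  fix x y assume *: "x \<in> Q" "y \<in> Q" "(i - x) mod int q = (i - y) mod int q"
  hence "int q dvd (i - x) - (i - y)" by (simp add: mod_eq_dvd_iff)
  hence "int q dvd y - x" by simp
  thus "x = y" using * residues_not_dvd_diff unfolding Q_def by blast
qed

lemma inj_add: "inj_on (\<lambda>j. (i + j) mod int q) Q"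
proof (rule inj_onI)
  fix x y assume *: "x \<in> Q" "y \<in> Q" "(i + x) mod int q = (i + y) mod int q"
  hence "int q dvd (i + x) - (i + y)" by (simp add: mod_eq_dvd_iff)
  hence "int q dvd x - y" by simp
  thus "x = y" using * residues_not_dvd_diff unfolding Q_def by blast
qed

lemma sum_row_le:
  assumes "J' \<subseteq> Q" "\<And>k. k \<in> Q \<Longrightarrow> (g k :: int) \<ge> 0"
  shows "(\<Sum>j\<in>J'. g ((i - j) mod int q)) \<le> (\<Sum>k\<in>Q. g k)"
proof -
  have "(\<Sum>j\<in>J'. g ((i - j) mod int q)) = sum g ((\<lambda>j. (i - j) mod int q) ` J')"
    by (simp add: sum.reindex[OF inj_on_subset[OF inj_diff assms(1)]])
  also have "\<dots> \<le> sum g Q"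
    using assms by (intro sum_mono2) auto
  finally show ?thesis .
qed

lemma sum_row_f:
  assumes "J' \<subseteq> Q"
  shows "(\<Sum>l\<in>(\<lambda>j. (i + j) mod int q) ` J'. int (f l)) = (\<Sum>j\<in>J'. int (f ((i + j) mod int q)))"
  by (simp add: sum.reindex[OF inj_on_subset[OF inj_add assms]])

lemma card_row:
  assumes "J' \<subseteq> Q"
  shows "card ((\<lambda>j. (i + j) mod int q) ` J') = card J'"
  using card_image[OF inj_on_subset[OF inj_add assms]] .

text \<open>The classes counted carry non-empty fibres of a sumset with F < q elements, so the
  alternative q in \<open>card_rsum_ge\<close> cannot occur.\<close>

lemma card_rsum_fibres:
  assumes "I' \<subseteq> I" "I' \<noteq> {}" "\<And>l. l \<in> rsum q (K t) I' J \<Longrightarrow> f l \<ge> 1"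
  shows "int (card (rsum q (K t) I' J)) \<ge> int (card I') + n - 1 - lam t"
proof -
  have sub: "rsum q (K t) I' J \<subseteq> Q" using rsum_subset[OF q_pos] by (simp add: Q_def)
  have "(\<Sum>l\<in>rsum q (K t) I' J. 1) \<le> (\<Sum>l\<in>rsum q (K t) I' J. int (f l))"
    by (rule sum_mono) (use assms(3) in fastforce)
  also have "\<dots> \<le> F" using sub by (intro sum_mono2) auto
  finally have "int (card (rsum q (K t) I' J)) < int q" using F_less by simp
  have "card (K t) < q"
  proof -
    have "card (K t) \<le> card (K 0)" by (rule card_mono) (auto simp: K_def)
    thus ?thesis using K_less by (simp add: K_def Q_def)
  qed
  show ?thesis
  proof -
    have "I' \<subseteq> {0..<int q}" "J \<subseteq> {0..<int q}" "J \<noteq> {}"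
      using assms(1) subsets n_pos by (auto simp: Q_def)
    from card_rsum_ge[OF q this(1,2) assms(2) this(3) finites(3) \<open>card (K t) < q\<close>]
    show ?thesis using \<open>int (card (rsum q (K t) I' J)) < int q\<close> by (simp add: lam_def split: if_splits)
  qed
qed

text \<open>A fibre over \<open>i + j\<close> with \<open>a i \<ge> h + t\<close> and at most \<open>t\<close> forbidden differences over \<open>i - j\<close> has at
  least \<open>h\<close> elements; count such fibres for every \<open>h\<close>.\<close>
lemma layers:
  assumes i1: "i1 \<in> I" "\<And>i. i \<in> I \<Longrightarrow> a i \<le> a i1" and t: "t \<le> a i1" and R: "R \<subseteq> Q"
  shows "(\<Sum>l\<in>Q - R. int (f l)) \<ge>
    A - int t * m + (int (a i1) - int t) * (n - 1 - lam t - int (card R))"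
proof -
  define c where "c = n - 1 - lam t - int (card R)"
  have finR: "finite R" using R finite_Q finite_subset by metis
  have layer: "int (card {l \<in> Q - R. h \<le> f l}) \<ge> int (card {i \<in> I. h + t \<le> a i}) + c"
    if h: "h \<in> {1..a i1 - t}" for h
  proof -
    define I' where "I' = {i \<in> I. h + t \<le> a i}"
    have sub: "l \<in> Q \<and> h \<le> f l" if l: "l \<in> rsum q (K t) I' J" for l
    proof -
      obtain i j where ij: "i \<in> I'" "j \<in> J" "l = (i + j) mod int q" "(i - j) mod int q \<notin> K t"
        using l by (auto simp: rsum_def)
      hence "s ((i - j) mod int q) \<le> t" by (auto simp: K_def)
      moreover have "a i \<le> f l + s ((i - j) mod int q)"
        using fib_a[of i j] ij by (auto simp: I'_def I_def J_def Q_def)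
      ultimately show ?thesis using ij by (auto simp: I'_def)
    qed
    have "int (card I') + n - 1 - lam t \<le> int (card (rsum q (K t) I' J))"
    proof (rule card_rsum_fibres)
      show "I' \<noteq> {}" using i1 h by (auto simp: I'_def)
      show "f l \<ge> 1" if "l \<in> rsum q (K t) I' J" for l using sub[OF that] h by auto
    qed (auto simp: I'_def)
    also have "card (rsum q (K t) I' J) \<le> card ({l \<in> Q - R. h \<le> f l} \<union> R)"
      using sub finR by (intro card_mono) auto
    also have "\<dots> \<le> card {l \<in> Q - R. h \<le> f l} + card R" by (rule card_Un_le)
    finally show ?thesis by (simp add: I'_def c_def)
  qed
  have "A - int t * m + (int (a i1) - int t) * c \<le> (\<Sum>i\<in>I. int (a i - t)) + int (a i1 - t) * c"
  proof -
    have "(\<Sum>i\<in>I. int (a i) - int t) \<le> (\<Sum>i\<in>I. int (a i - t))" by (rule sum_mono) auto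
    moreover have "(\<Sum>i\<in>I. int (a i) - int t) = A - int t * m"
      by (simp add: sum_subtractf sum_I)
    ultimately show ?thesis using t by (simp add: of_nat_diff)
  qed
  also have "(\<Sum>i\<in>I. int (a i - t)) = int (\<Sum>h\<in>{1..a i1 - t}. card {i \<in> I. h + t \<le> a i})"
    using sum_layers_above[of I a "a i1" t] i1 by simp
  also have "\<dots> + int (a i1 - t) * c = (\<Sum>h\<in>{1..a i1 - t}. int (card {i \<in> I. h + t \<le> a i}) + c)"
    by (simp add: sum.distrib)
  also have "\<dots> \<le> (\<Sum>h\<in>{1..a i1 - t}. int (card {l \<in> Q - R. h \<le> f l}))"
    by (rule sum_mono) (rule layer)
  also have "\<dots> \<le> int (\<Sum>l\<in>Q - R. f l)"
    using sum_ge_layers[of "Q - R" f "a i1 - t"] by (simp flip: of_nat_sum)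
  finally show ?thesis by (simp add: c_def)
qed

lemma split_F: "R \<subseteq> Q \<Longrightarrow> F = (\<Sum>l\<in>R. int (f l)) + (\<Sum>l\<in>Q - R. int (f l))"
  by (simp add: sum.subset_diff[of R Q] add.commute)

text \<open>The row through the largest fibre of A is estimated by the weak bound, all other fibres
  by layers. Removing the n classes of the row takes n from each layer and leaves -1 -
  \<open>lam t\<close>. In the row the loss beyond 1 is 9s - 7 for a class with s > 0 forbidden
  differences, at most 9S - 7\<kappa> in total.\<close>

lemma row_bound:
  assumes i1: "i1 \<in> I" "\<And>i. i \<in> I \<Longrightarrow> a i \<le> a i1" and t: "t \<le> a i1"
  shows "F \<ge> n * (int (a i1) - 1) + B - 9 * S + 7 * \<kappa> + A - int (a i1)
    - (int t * (m - 1) + (int (a i1) - int t) * lam t)"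
proof -
  define R where "R = (\<lambda>j. (i1 + j) mod int q) ` J"
  have R: "R \<subseteq> Q" "card R = card J" using card_row[OF subsets(2)] by (auto simp: R_def)
  define g where "g k = (if s k = 0 then 0 else 9 * int (s k) - 7)" for k
  have g: "weak_loss (s k) = g k + 1" for k by (simp add: weak_loss_def g_def)
  have "(\<Sum>j\<in>J. int (a i1) + int (b j) - (g ((i1 - j) mod int q) + 1)) \<le> (\<Sum>l\<in>R. int (f l))"
    unfolding R_def sum_row_f[OF subsets(2)]
  proof (rule sum_mono)
    fix j assume "j \<in> J"
    thus "int (a i1) + int (b j) - (g ((i1 - j) mod int q) + 1) \<le> int (f ((i1 + j) mod int q))"
      using fib_weak[of i1 j] i1(1) by (auto simp: g I_def J_def Q_def)
  qed
  moreover have "(\<Sum>j\<in>J. int (a i1) + int (b j) - (g ((i1 - j) mod int q) + 1)) =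
      n * (int (a i1) - 1) + B - (\<Sum>j\<in>J. g ((i1 - j) mod int q))"
    by (simp add: sum.distrib sum_subtractf sum_J algebra_simps)
  moreover have "(\<Sum>j\<in>J. g ((i1 - j) mod int q)) \<le> (\<Sum>k\<in>Q. g k)"
    by (rule sum_row_le[OF subsets(2)]) (simp add: g_def)
  moreover have "(\<Sum>k\<in>Q. g k) = 9 * S - 7 * \<kappa>"
  proof -
    have "(\<Sum>k\<in>Q. g k) = (\<Sum>k\<in>K 0. 9 * int (s k) - 7)"
      by (rule sum.mono_neutral_cong_right) (auto simp: K_def g_def)
    thus ?thesis by (simp add: sum_subtractf sum_distrib_left[symmetric] sum_K)
  qed
  ultimately show ?thesis
    using layers[OF i1 t R(1)] split_F[OF R(1)] R(2) by (simp add: algebra_simps)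
qed

lemma trivial_bound: "F \<ge> B - S"
proof -
  obtain i where i: "i \<in> I" using m_pos by fastforce
  have "(\<Sum>j\<in>J. int (b j) - int (s ((i - j) mod int q))) \<le> (\<Sum>j\<in>J. int (f ((i + j) mod int q)))"
  proof (rule sum_mono)
    fix j assume "j \<in> J"
    thus "int (b j) - int (s ((i - j) mod int q)) \<le> int (f ((i + j) mod int q))"
      using fib_b[of i j] i by (auto simp: I_def J_def Q_def)
  qed
  also have "\<dots> = (\<Sum>l\<in>(\<lambda>j. (i + j) mod int q) ` J. int (f l))"
    using sum_row_f[OF subsets(2)] by simp
  also have "\<dots> \<le> F"
    by (rule sum_mono2) auto
  finally have "B - (\<Sum>j\<in>J. int (s ((i - j) mod int q))) \<le> F"
    by (simp add: sum_subtractf sum_J)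
  moreover have "(\<Sum>j\<in>J. int (s ((i - j) mod int q))) \<le> S"
    by (rule sum_row_le[OF subsets(2)]) simp
  ultimately show ?thesis by linarith
qed

text \<open>Uses only fibres without forbidden differences, which is enough when \<open>B\<close> meets many cosets.\<close>
lemma free_bound:
  assumes i1: "i1 \<in> I" "\<And>i. i \<in> I \<Longrightarrow> a i \<le> a i1" and \<beta>: "\<And>j. j \<in> J \<Longrightarrow> b j \<le> \<beta>"
    and \<kappa>: "\<kappa> \<ge> 1" and cond: "\<kappa> * (int \<beta> - 1) \<le> (n - \<kappa> - 2) * (int (a i1) - 1)"
  shows "F \<ge> A + B - S - 2"
proof -
  define J1 where "J1 = {j \<in> J. s ((i1 - j) mod int q) = 0}"
  define R where "R = (\<lambda>j. (i1 + j) mod int q) ` J1"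
  define \<rho> where "\<rho> = int (card (J - J1))"
  have J1: "J1 \<subseteq> J" "J1 \<subseteq> Q" using subsets by (auto simp: J1_def)
  have R: "R \<subseteq> Q" "card R = card J1" using card_row[OF J1(2)] by (auto simp: R_def)
  have \<rho>: "int (card J1) = n - \<rho>"
    using J1 by (simp add: \<rho>_def card_Diff_subset finite_subset of_nat_diff card_mono)
  have "card (J - J1) \<le> card (K 0)"
    by (rule card_inj_on_le[OF inj_on_subset[OF inj_diff[of i1]]])
      (use subsets in \<open>auto simp: J1_def K_def\<close>)
  hence "\<rho> \<le> \<kappa>" by (simp add: \<rho>_def)
  have "(\<Sum>j\<in>J1. int (a i1) + int (b j) - 1) \<le> (\<Sum>l\<in>R. int (f l))"
    unfolding R_def sum_row_f[OF J1(2)]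
  proof (rule sum_mono)
    fix j assume "j \<in> J1"
    thus "int (a i1) + int (b j) - 1 \<le> int (f ((i1 + j) mod int q))"
      using fib_weak[of i1 j] i1(1) by (auto simp: J1_def weak_loss_def I_def J_def Q_def)
  qed
  moreover have "(\<Sum>j\<in>J1. int (a i1) + int (b j) - 1) =
      (n - \<rho>) * (int (a i1) - 1) + (\<Sum>j\<in>J1. int (b j))"
    by (simp add: sum.distrib sum_subtractf \<rho>[symmetric] algebra_simps)
  moreover have "(\<Sum>j\<in>J1. int (b j)) \<ge> B - \<rho> * int \<beta>"
  proof -
    have "(\<Sum>j\<in>J - J1. int (b j)) \<le> \<rho> * int \<beta>"
      using sum_bounded_above[of "J - J1" "\<lambda>j. int (b j)" "int \<beta>"] \<beta> by (simp add: \<rho>_def)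
    moreover have "B = (\<Sum>j\<in>J - J1. int (b j)) + (\<Sum>j\<in>J1. int (b j))"
      using J1 sum.subset_diff[of J1 J "\<lambda>j. int (b j)"] by (simp add: sum_J)
    ultimately show ?thesis by linarith
  qed
  moreover have "(\<Sum>l\<in>Q - R. int (f l)) \<ge> A + int (a i1) * (\<rho> - \<kappa> - 2)"
  proof -
    have "lam 0 = \<kappa> + 1" using \<kappa> by (auto simp: lam_def)
    thus ?thesis using layers[OF i1 _ R(1), of 0] R(2) \<rho> by (simp add: algebra_simps)
  qed
  \<comment> \<open>The terms \<rho> * a i1 from the row and from the layers cancel, so only \<rho>
    * (\<beta> - 1) is left to be compared with \<open>cond\<close>.\<close>
  moreover have "\<rho> * (int \<beta> - 1) \<le> \<kappa> * (int \<beta> - 1)"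
  proof -
    have "J \<noteq> {}" using n_pos by auto
    then obtain j where "j \<in> J" by blast
    hence "\<beta> \<ge> 1" using \<beta>[of j] by (auto simp: J_def)
    thus ?thesis using \<open>\<rho> \<le> \<kappa>\<close> by (intro mult_right_mono) auto
  qed
  ultimately show ?thesis
    using split_F[OF R(1)] cond kappa_le by (simp add: algebra_simps)
qed

end

section \<open>The numerical choice of the level t\<close>

lemma size_threshold_mono: "1 \<le> x \<Longrightarrow> x \<le> y \<Longrightarrow> size_threshold x \<le> size_threshold y"
proof -
  assume "1 \<le> x" "x \<le> y"
  then obtain d where d: "y = x + d" using le_Suc_ex by blast
  have "0 \<le> int d * (18 * int x + 9 * int d - 5)" using \<open>1 \<le> x\<close> by simp
  thus ?thesis by (simp add: d size_threshold_def power2_eq_square algebra_simps)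
qed

text \<open>Here e is the excess |S| - \<kappa> and c t is |K t|. For the row bound to yield the
  weak bound, the cost of the layers must not exceed (n - 1)(\<alpha> - 1) + 7(\<kappa> - 1). If m
  \<ge> \<kappa> + 2, then t = 0 works; otherwise t is half of \<alpha> - 1, rounded up, where t * c
  t \<le> e makes c t small.\<close>

lemma weak_layer_choice:
  fixes m n \<kappa> e \<alpha> :: int and c :: "int \<Rightarrow> int"
  assumes "1 \<le> m" "m \<le> n" "m \<le> 2 * \<kappa> + 1" "1 \<le> \<kappa>" "2 \<le> \<alpha>" "\<alpha> \<le> e + 1"
    and size: "8 * (\<kappa> + e) - 5 \<le> m * \<alpha>"
    and c: "c 0 = \<kappa>" "\<And>t. 0 \<le> t \<Longrightarrow> t * c t \<le> e" "\<And>t. 0 \<le> c t"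
  obtains t where "0 \<le> t" "t \<le> \<alpha>"
    "t * (m - 1) + (\<alpha> - t) * (c t + 1) \<le> (n - 1) * (\<alpha> - 1) + 7 * (\<kappa> - 1)"
proof -
  define y g where "y = m - 1" and "g = \<alpha> - 1"
  have g: "1 \<le> g" "g \<le> e" and y: "0 \<le> y" "y \<le> 2 * \<kappa>" using assms by (auto simp: y_def g_def)
  have yg: "y * g \<ge> 6 * \<kappa> + 7 * e - 6"
    using size g y by (simp add: y_def g_def algebra_simps)
  have ng: "y * g \<le> (n - 1) * g" using assms g by (intro mult_right_mono) (auto simp: y_def)
  have "\<kappa> \<ge> 2"
  proof (rule ccontr)
    assume "\<not> \<kappa> \<ge> 2"
    hence "y \<le> 2" "\<kappa> = 1" using y assms by auto
    hence "y * g \<le> 2 * g" using g by (intro mult_right_mono) auto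
    thus False using yg g \<open>\<kappa> = 1\<close> by linarith
  qed
  show thesis
  proof (cases "y \<ge> \<kappa> + 1")
    case True
    hence "(\<kappa> + 1) * g \<le> y * g" using g by (intro mult_right_mono) auto
    hence "(\<kappa> + 1) * (g + 1) \<le> (n - 1) * g + 7 * (\<kappa> - 1)"
      using ng \<open>\<kappa> \<ge> 2\<close> by (simp add: algebra_simps)
    thus thesis using that[of 0] assms c(1) by (simp add: g_def algebra_simps)
  next
    case False
    define h \<tau> where "h = g div 2" and "\<tau> = g - g div 2"
    have h: "0 \<le> h" "2 * h \<le> g" "g - 1 \<le> 2 * h" "h \<le> \<tau>" "1 \<le> \<tau>" "\<tau> + h = g"
      using g by (auto simp: h_def \<tau>_def)
    have "h * c \<tau> \<le> \<tau> * c \<tau>" "1 * c \<tau> \<le> \<tau> * c \<tau>"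
      using h c(3)[of \<tau>] by (auto intro!: mult_right_mono simp del: mult_1)
    moreover have "\<tau> * c \<tau> \<le> e" using c(2) h by auto
    ultimately have 1: "(h + 1) * (c \<tau> + 1) \<le> 2 * e + h + 1"
      by (simp add: algebra_simps)
    have "(g - 1) * y \<le> (2 * h) * y" using h y by (intro mult_right_mono) auto
    hence "2 * (h * y) \<ge> 5 * \<kappa> + 7 * e - 6" using yg False by (simp add: algebra_simps)
    moreover have "2 * e + h + 1 \<le> z + 7 * (\<kappa> - 1)"
      if "5 * \<kappa> + 7 * e - 6 \<le> 2 * z" for z
    proof -
      have "2 * h \<le> e" using h(2) g(2) by simp
      hence "2 * (2 * e + h + 1) \<le> 5 * e + 2" by simp
      also have "\<dots> \<le> 5 * \<kappa> + 7 * e - 6 + 14 * (\<kappa> - 1)"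
        using g \<open>\<kappa> \<ge> 2\<close> by simp
      also have "\<dots> \<le> 2 * (z + 7 * (\<kappa> - 1))" using that by simp
      finally show ?thesis by simp
    qed
    ultimately have "2 * e + h + 1 \<le> h * y + 7 * (\<kappa> - 1)" by blast
    hence "(h + 1) * (c \<tau> + 1) \<le> h * y + 7 * (\<kappa> - 1)"
      using 1 by (rule order_trans[rotated])
    moreover have "\<alpha> - \<tau> = h + 1" using h(6) by (simp add: g_def)
    moreover have "y * g = \<tau> * y + h * y" using h(6) by (simp flip: distrib_right)
    ultimately show thesis
      using that[of \<tau>] h ng by (auto simp: y_def g_def)
  qed
qed

text \<open>At t = e + 1 no class has more than t forbidden differences, so the layers cost only t(m
  - 1). Aiming at the loss |S| + 2, the row bound then asks for the second inequality, where
  \<kappa> + 8e stands for 8|S| - 7\<kappa>.\<close>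

lemma main_layer_choice:
  fixes m n \<kappa> e \<alpha> :: int
  assumes "2 \<le> m" "m \<le> n" "m \<le> 2 * \<kappa> + 1" "1 \<le> \<kappa>" "0 \<le> e" "2 \<le> \<kappa> + e"
    and size: "9 * (\<kappa> + e)\<^sup>2 - 5 * (\<kappa> + e) - 3 \<le> m * \<alpha>"
  shows "e + 2 \<le> \<alpha>" "(e + 1) * (m - 1) + \<kappa> + 8 * e \<le> (n - 1) * (\<alpha> - 1) + 1"
proof -
  have M: "9 * (\<kappa> * \<kappa>) + 18 * (\<kappa> * e) + 9 * (e * e) - 5 * \<kappa> - 5 * e - 3 \<le> m * \<alpha>"
    using size by (simp add: power2_eq_square algebra_simps)
  have ke: "e \<le> \<kappa> * e" "\<kappa> \<le> \<kappa> * \<kappa>" "e \<le> e * e"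
    using assms mult_right_mono[of 1 \<kappa> e] mult_right_mono[of 1 \<kappa> \<kappa>]
    by (auto simp: mult_le_cancel_left1)
  have big: "\<kappa> \<ge> 2 \<Longrightarrow> 2 * \<kappa> \<le> \<kappa> * \<kappa>" "\<kappa> \<ge> 2 \<Longrightarrow> 2 * e \<le> \<kappa> * e" "e \<ge> 2 \<Longrightarrow> 2 * e \<le> e * e"
    using assms by (auto intro!: mult_right_mono)
  show \<alpha>: "e + 2 \<le> \<alpha>"
  proof (rule ccontr)
    assume "\<not> e + 2 \<le> \<alpha>"
    hence "m * \<alpha> \<le> m * (e + 1)" using assms by (intro mult_left_mono) auto
    also have "\<dots> \<le> (2 * \<kappa> + 1) * (e + 1)" using assms by (intro mult_right_mono) auto
    also have "\<dots> = 2 * (\<kappa> * e) + 2 * \<kappa> + e + 1" by (simp add: algebra_simps)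
    finally show False using M ke big assms by linarith
  qed
  \<comment> \<open>The surplus of the largest fibre: (m - 1) * d is what pays for \<kappa> +
    8e.\<close>
  define d where "d = \<alpha> - 2 - e"
  have d: "d \<ge> 0" using \<alpha> by (simp add: d_def)
  have md: "m * \<alpha> = m * d + m * (e + 2)" by (simp add: d_def algebra_simps)
  have "(m - 1) * d + 1 \<ge> \<kappa> + 8 * e"
  \<comment> \<open>The general estimate, which uses m \<le> 2(m - 1), is too weak for \<kappa> = e
    = 1; there m is 2 or 3 and the size hypothesis reads 23 \<le> m * \<alpha>.\<close>
  proof (cases "\<kappa> = 1 \<and> e = 1")
    case True
    hence "m = 2 \<or> m = 3" using assms by auto
    thus ?thesis using True M by (auto simp: d_def)
  next
    case False
    have "m * (e + 2) \<le> (2 * \<kappa> + 1) * (e + 2)" using assms by (intro mult_right_mono) auto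
    also have "\<dots> = 2 * (\<kappa> * e) + 4 * \<kappa> + e + 2" by (simp add: algebra_simps)
    finally have "m * d \<ge> 9 * (\<kappa> * \<kappa>) + 16 * (\<kappa> * e) + 9 * (e * e) - 9 * \<kappa> - 6 * e - 5"
      using M md by linarith
    moreover have "9 * (\<kappa> * \<kappa>) + 16 * (\<kappa> * e) + 9 * (e * e) - 9 * \<kappa> - 6 * e - 5 \<ge> 2 * \<kappa> + 16 * e - 2"
    proof (cases "\<kappa> \<ge> 2")
      case True
      thus ?thesis using big ke assms by linarith
    next
      case False
      hence "\<kappa> = 1" "e \<ge> 2" using assms \<open>\<not> (\<kappa> = 1 \<and> e = 1)\<close> by auto
      thus ?thesis using big(3) by (simp, linarith)
    qed
    moreover have "m * d \<le> 2 * ((m - 1) * d)"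
      using mult_right_mono[of m "2 * (m - 1)" d] assms d by (simp add: algebra_simps)
    ultimately show ?thesis by linarith
  qed
  moreover have "(m - 1) * (\<alpha> - 1) = (m - 1) * d + (e + 1) * (m - 1)"
    by (simp add: d_def algebra_simps)
  moreover have "(m - 1) * (\<alpha> - 1) \<le> (n - 1) * (\<alpha> - 1)"
    using assms \<alpha> by (intro mult_right_mono) auto
  ultimately show "(e + 1) * (m - 1) + \<kappa> + 8 * e \<le> (n - 1) * (\<alpha> - 1) + 1" by linarith
qed

section \<open>Bounds for the whole sumset from its fibres\<close>

context fibration
begin

lemma bij_neg: "bij_betw (\<lambda>k. (- k) mod int q) Q Q"
  by (rule bij_betw_byWitness[where f' = "\<lambda>k. (- k) mod int q"])
    (auto simp: mod_minus_eq, auto simp: Q_def)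

lemma card_neg: "card {k \<in> Q. P ((- k) mod int q)} = card {k \<in> Q. P k}"
proof -
  have "(\<lambda>k. (- k) mod int q) ` {k \<in> Q. P ((- k) mod int q)} = {k \<in> Q. P k}"
  proof (intro equalityI subsetI)
    fix k assume k: "k \<in> {k \<in> Q. P k}"
    moreover have "(- ((- k) mod int q)) mod int q = k"
      using k by (simp add: mod_minus_eq Q_def)
    ultimately show "k \<in> (\<lambda>k. (- k) mod int q) ` {k \<in> Q. P ((- k) mod int q)}"
      by (intro image_eqI[of _ _ "(- k) mod int q"]) auto
  qed auto
  hence "bij_betw (\<lambda>k. (- k) mod int q) {k \<in> Q. P ((- k) mod int q)} {k \<in> Q. P k}"
    by (intro bij_betw_subset[OF bij_neg]) auto
  thus ?thesis by (rule bij_betw_same_card)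
qed

lemma neg_mod_diff: "(- ((j - i) mod int q)) mod int q = (i - j) mod int q"
  by (simp add: mod_minus_eq)

lemma fibration_swap: "fibration q p b a (\<lambda>k. s ((- k) mod int q)) f"
proof
  show "card {k \<in> {0..<int q}. s ((- k) mod int q) > 0} < q"
    using K_less card_neg[of "\<lambda>k. s k > 0"] by (simp add: Q_def)
next
  fix i j assume *: "i \<in> {0..<int q}" "j \<in> {0..<int q}" "b i > 0" "a j > 0"
  show "b i \<le> f ((i + j) mod int q) + s ((- ((i - j) mod int q)) mod int q)"
    using fib_b[of j i] * by (simp add: neg_mod_diff add.commute)
  show "a j \<le> f ((i + j) mod int q) + s ((- ((i - j) mod int q)) mod int q)"
    using fib_a[of j i] * by (simp add: neg_mod_diff add.commute)
  show "int (b i) + int (a j) \<le>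
      int (f ((i + j) mod int q)) + weak_loss (s ((- ((i - j) mod int q)) mod int q))"
    using fib_weak[of j i] * by (simp add: neg_mod_diff add.commute)
qed (use q pq total_less I_ne J_ne in auto)

lemma free_bound_swap:
  assumes j1: "j1 \<in> J" "\<And>j. j \<in> J \<Longrightarrow> b j \<le> b j1" and \<alpha>: "\<And>i. i \<in> I \<Longrightarrow> a i \<le> \<alpha>"
    and \<kappa>: "\<kappa> \<ge> 1" and cond: "\<kappa> * (int \<alpha> - 1) \<le> (m - \<kappa> - 2) * (int (b j1) - 1)"
  shows "F \<ge> A + B - S - 2"
proof -
  interpret sw: fibration q p b a "\<lambda>k. s ((- k) mod int q)" f by (rule fibration_swap)
  have sets: "sw.I = J" "sw.J = I"
    by (simp_all add: sw.I_def J_def sw.J_def I_def)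
  have K: "card (sw.K 0) = card (K 0)"
    using card_neg[of "\<lambda>k. s k > 0"] by (simp only: sw.K_def K_def sw.Q_def Q_def)
  have "(\<Sum>k\<in>Q. int (s ((- k) mod int q))) = S"
    using sum.reindex_bij_betw[OF bij_neg, of "\<lambda>k. int (s k)"] .
  moreover have "(\<Sum>x\<in>Q. int (b x)) + (\<Sum>x\<in>Q. int (a x)) - (\<Sum>k\<in>Q. int (s ((- k) mod int q))) - 2 \<le> F"
    using sw.free_bound[unfolded sets K, OF j1 \<alpha> \<kappa> cond] .
  ultimately show ?thesis by simp
qed

text \<open>Each of the \<kappa> classes holds at least one forbidden difference, which leaves S -
  \<kappa> to distribute. A class with more than t takes at least t of these, and no class holds
  more than S - \<kappa> + 1.\<close>

lemma excess:
  "int t * int (card (K t)) \<le> S - \<kappa>" "S - \<kappa> \<ge> 0" "lam (nat (S - \<kappa> + 1)) = 0"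
proof -
  have eq: "S - \<kappa> = (\<Sum>k\<in>K 0. int (s k) - 1)" by (simp add: sum_subtractf sum_K)
  have "int t * int (card (K t)) = (\<Sum>k\<in>K t. int t)" by simp
  also have "\<dots> \<le> (\<Sum>k\<in>K t. int (s k) - 1)" by (rule sum_mono) (auto simp: K_def)
  also have "\<dots> \<le> (\<Sum>k\<in>K 0. int (s k) - 1)" by (rule sum_mono2) (auto simp: K_def)
  finally show "int t * int (card (K t)) \<le> S - \<kappa>" by (simp add: eq)
  show ge: "S - \<kappa> \<ge> 0" using kappa_le by simp
  have "int (s k) \<le> S - \<kappa> + 1" if "k \<in> K 0" for k
  proof -
    have "int (s k) - 1 \<le> (\<Sum>k\<in>K 0. int (s k) - 1)"
      by (rule member_le_sum[OF that]) (auto simp: K_def)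
    thus ?thesis by (simp add: eq)
  qed
  hence "K (nat (S - \<kappa> + 1)) = {}" using ge by (fastforce simp: K_def)
  thus "lam (nat (S - \<kappa> + 1)) = 0" by (simp add: lam_def)
qed

lemma obtain_max:
  obtains i j where "i \<in> I" "\<And>x. x \<in> I \<Longrightarrow> a x \<le> a i" "j \<in> J" "\<And>y. y \<in> J \<Longrightarrow> b y \<le> b j"
proof -
  have "I \<noteq> {}" "J \<noteq> {}" using m_pos n_pos by auto
  hence "Max (a ` I) \<in> a ` I" "Max (b ` J) \<in> b ` J" by simp_all
  then obtain i j where ij: "i \<in> I" "a i = Max (a ` I)" "j \<in> J" "b j = Max (b ` J)"
    by (metis imageE)
  show thesis by (rule that[OF ij(1) _ ij(3)]) (simp_all add: ij)
qed

lemma A_le: "(\<And>i. i \<in> I \<Longrightarrow> a i \<le> x) \<Longrightarrow> A \<le> m * int x"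
  using sum_bounded_above[of I "\<lambda>i. int (a i)" "int x"] by (simp add: sum_I)

text \<open>The row is taken through the larger of the two largest fibres. With at least 2\<kappa> +
  2 classes, \<kappa> or more remain after subtracting \<kappa> + 2, and they pay for the at most
  \<kappa> fibres of the row that are given up.\<close>

lemma free_case:
  assumes "\<kappa> \<ge> 1" "m \<le> n" "m \<ge> 2 * \<kappa> + 2"
  shows "F \<ge> A + B - S - 2"
proof -
  obtain i j where i: "i \<in> I" "\<And>x. x \<in> I \<Longrightarrow> a x \<le> a i"
    and j: "j \<in> J" "\<And>y. y \<in> J \<Longrightarrow> b y \<le> b j"
    by (rule obtain_max) blast
  have pos: "a i \<ge> 1" "b j \<ge> 1" using i j by (auto simp: I_def J_def)
  show ?thesis
  proof (cases "b j \<le> a i")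
    case True
    have "\<kappa> * (int (b j) - 1) \<le> (n - \<kappa> - 2) * (int (a i) - 1)"
      using True assms pos by (intro mult_mono) auto
    thus ?thesis using free_bound[OF i j(2) assms(1)] by blast
  next
    case False
    have "\<kappa> * (int (a i) - 1) \<le> (m - \<kappa> - 2) * (int (b j) - 1)"
      using False assms pos by (intro mult_mono) auto
    thus ?thesis using free_bound_swap[OF j i(2) assms(1)] by blast
  qed
qed

theorem weak_bound:
  assumes "m \<le> n"
  shows "F \<ge> A + B - weak_loss (sum s Q)"
proof -
  obtain i1 j1 where i1: "i1 \<in> I" "\<And>x. x \<in> I \<Longrightarrow> a x \<le> a i1"
    and j1: "j1 \<in> J" "\<And>y. y \<in> J \<Longrightarrow> b y \<le> b j1"
    by (rule obtain_max) blast
  define \<alpha> where "\<alpha> = int (a i1)"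
  have pos: "\<alpha> \<ge> 1" using i1 by (auto simp: \<alpha>_def I_def)
  have S: "S = int (sum s Q)" by simp
  have row: "F \<ge> n * (\<alpha> - 1) + B - 9 * S + 7 * \<kappa> + A - \<alpha>
      - (int t * (m - 1) + (\<alpha> - int t) * lam t)" if "t \<le> a i1" for t
    unfolding \<alpha>_def using i1(2) that by (rule row_bound[OF i1(1)])
  show ?thesis
  proof (cases "K 0 = {}")
    case True
    hence zero: "\<kappa> = 0" "S = 0" using sum_K by simp_all
    have "lam 0 = 0" using True by (simp add: lam_def)
    hence "F \<ge> n * (\<alpha> - 1) + B - 9 * S + 7 * \<kappa> + A - \<alpha>"
      using row[of 0] by simp
    moreover have "n * (\<alpha> - 1) = (n - 1) * (\<alpha> - 1) + \<alpha> - 1"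
      by (simp add: algebra_simps)
    moreover have "(n - 1) * (\<alpha> - 1) \<ge> 0" using n_pos pos by simp
    moreover have "weak_loss (sum s Q) = 1"
    proof -
      have "sum s Q = 0" using zero(2) S by linarith
      thus ?thesis by (simp add: weak_loss_def)
    qed
    ultimately show ?thesis using zero by linarith
  next
    case False
    hence \<kappa>: "\<kappa> \<ge> 1" by (simp add: Suc_le_eq card_gt_0_iff)
    have "sum s Q \<noteq> 0" using \<kappa> kappa_le S by linarith
    hence w: "weak_loss (sum s Q) = 9 * S - 6" by (simp add: weak_loss_def)
    have S1: "S \<ge> 1" using \<kappa> kappa_le by linarith
    have rowS: "F \<ge> A + B - (9 * S - 6)"
      if "int t * (m - 1) + (\<alpha> - int t) * lam t \<le> (n - 1) * (\<alpha> - 1) + 7 * (\<kappa> - 1)" "t \<le> a i1" for t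
      using row[OF that(2)] that(1) by (simp add: algebra_simps)
    \<comment> \<open>Outside the first two cases A \<ge> 8S - 5 and m \<le> 2\<kappa> + 1. For
      \<alpha> = 1 the left side of the condition in \<open>free_bound_swap\<close> is 0; for
      \<alpha> \<ge> S - \<kappa> + 2 there is room for the level at which \<open>lam\<close>
      vanishes; sizes in between need an intermediate level.\<close>
    consider "m \<ge> 2 * \<kappa> + 2" | "A \<le> 8 * S - 6" | "\<alpha> = 1" "m \<ge> \<kappa> + 2"
      | "\<alpha> = 1" "m \<le> \<kappa> + 1" "A \<ge> 8 * S - 5" | "\<alpha> \<ge> S - \<kappa> + 2"
      | "m \<le> 2 * \<kappa> + 1" "A \<ge> 8 * S - 5" "2 \<le> \<alpha>" "\<alpha> \<le> S - \<kappa> + 1"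
      using pos by linarith
    hence "F \<ge> A + B - (9 * S - 6)"
    proof cases
      case 1
      thus ?thesis using free_case[OF \<kappa> assms 1] S1 by linarith
    next
      case 2
      thus ?thesis using trivial_bound by linarith
    next
      case 3
      have "b j1 \<ge> 1" using j1 by (auto simp: J_def)
      hence "\<kappa> * (int (a i1) - 1) \<le> (m - \<kappa> - 2) * (int (b j1) - 1)"
        using 3 by (simp add: \<alpha>_def)
      thus ?thesis using free_bound_swap[OF j1 i1(2) \<kappa>] S1 by linarith
    next
      case 4
      have "A \<le> m" using A_le[OF i1(2)] 4 by (simp add: \<alpha>_def)
      hence "\<kappa> \<ge> 2" using 4 \<kappa> kappa_le by linarith
      thus ?thesis using rowS[of 0] 4 False pos by (simp add: lam_def \<alpha>_def)
    next
      case 5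
      have "(S - \<kappa> + 1) * (m - 1) \<le> (\<alpha> - 1) * (n - 1)"
        using 5 assms m_pos excess(2) by (intro mult_mono) auto
      thus ?thesis
        using rowS[of "nat (S - \<kappa> + 1)"] 5 excess(2,3) \<kappa> by (simp add: \<alpha>_def mult.commute)
    next
      case 6
      define c where "c t = int (card (K (nat t)))" for t
      obtain t where t: "0 \<le> t" "t \<le> \<alpha>"
        "t * (m - 1) + (\<alpha> - t) * (c t + 1) \<le> (n - 1) * (\<alpha> - 1) + 7 * (\<kappa> - 1)"
      proof (rule weak_layer_choice[of m n \<kappa> \<alpha> "S - \<kappa>" c])
        show "8 * (\<kappa> + (S - \<kappa>)) - 5 \<le> m * \<alpha>" using A_le[OF i1(2)] 6 by (simp add: \<alpha>_def)
        show "t * c t \<le> S - \<kappa>" if "0 \<le> t" for t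
          using excess(1)[of "nat t"] that by (simp add: c_def)
      qed (use 6 m_pos assms \<kappa> in \<open>auto simp: c_def\<close>)
      have "(\<alpha> - t) * lam (nat t) \<le> (\<alpha> - t) * (c t + 1)"
        using t by (intro mult_left_mono) (auto simp: lam_def c_def)
      thus ?thesis using rowS[of "nat t"] t by (simp add: \<alpha>_def)
    qed
    thus ?thesis by (simp only: w)
  qed
qed

theorem strong_bound:
  assumes "m \<le> n" "m \<ge> 2" "S \<ge> 2" "A \<ge> size_threshold (sum s Q)"
  shows "F \<ge> A + B - S - 2"
proof -
  obtain i1 j1 where i1: "i1 \<in> I" "\<And>x. x \<in> I \<Longrightarrow> a x \<le> a i1"
    and "j1 \<in> J" "\<And>y. y \<in> J \<Longrightarrow> b y \<le> b j1"
    by (rule obtain_max) blast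
  define \<alpha> where "\<alpha> = int (a i1)"
  have "K 0 \<noteq> {}" using assms(3) sum_K by auto
  hence \<kappa>: "\<kappa> \<ge> 1" by (simp add: Suc_le_eq card_gt_0_iff)
  show ?thesis
  proof (cases "m \<ge> 2 * \<kappa> + 2")
    case True
    thus ?thesis using free_case[OF \<kappa> assms(1)] by blast
  next
    case False
    have "9 * S\<^sup>2 - 5 * S - 3 \<le> m * \<alpha>"
      using A_le[OF i1(2)] assms(4) by (simp add: size_threshold_def \<alpha>_def)
    hence large: "S - \<kappa> + 2 \<le> \<alpha>"
      "(S - \<kappa> + 1) * (m - 1) + \<kappa> + 8 * (S - \<kappa>) \<le> (n - 1) * (\<alpha> - 1) + 1"
      using main_layer_choice[of m n \<kappa> "S - \<kappa>" \<alpha>] assms False \<kappa> excess(2) by simp_all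
    have t: "nat (S - \<kappa> + 1) \<le> a i1"
      using large(1) unfolding \<alpha>_def by linarith
    have "F \<ge> n * (\<alpha> - 1) + B - 9 * S + 7 * \<kappa> + A - \<alpha>
        - (int (nat (S - \<kappa> + 1)) * (m - 1) + (\<alpha> - int (nat (S - \<kappa> + 1))) * lam (nat (S - \<kappa> + 1)))"
      unfolding \<alpha>_def using i1(2) t by (rule row_bound[OF i1(1)])
    moreover have "n * (\<alpha> - 1) = (n - 1) * (\<alpha> - 1) + \<alpha> - 1"
      by (simp add: algebra_simps)
    ultimately show ?thesis using large(2) excess(2,3) by simp
  qed
qed

text \<open>When A lies in one coset there is a single row, and the trivial loss k j is affordable
  in all fibres but one; only one has to supply a i + b j - k j - 2. Such a fibre exists: otherwise
  every fibre of B is below its own threshold and, thresholds of positive numbers being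
  superadditive, so is B.\<close>

theorem strong_bound_single_fibre:
  assumes "m = 1" "A \<ge> size_threshold (sum s Q)" "B \<ge> size_threshold (sum s Q)"
    and fib_strong: "\<And>i j. i \<in> {0..<int q} \<Longrightarrow> j \<in> {0..<int q} \<Longrightarrow> a i > 0 \<Longrightarrow> b j > 0 \<Longrightarrow>
      s ((i - j) mod int q) > 0 \<Longrightarrow>
      size_threshold (s ((i - j) mod int q)) \<le> int (a i) \<Longrightarrow>
      size_threshold (s ((i - j) mod int q)) \<le> int (b j) \<Longrightarrow>
      int (a i) + int (b j) \<le> int (f ((i + j) mod int q)) + int (s ((i - j) mod int q)) + 2"
  shows "F \<ge> A + B - S - 2"
proof -
  obtain i where i: "I = {i}" using assms(1) by (metis card_1_singletonE of_nat_eq_1_iff)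
  hence A: "A = int (a i)" using sum_I by simp
  have iQ: "i \<in> {0..<int q}" "a i > 0" using i by (auto simp: I_def Q_def)
  define k where "k j = s ((i - j) mod int q)" for j
  have k_sum: "(\<Sum>j\<in>J'. int (k j)) \<le> S" if "J' \<subseteq> Q" for J'
    unfolding k_def using sum_row_le[OF that, of "\<lambda>x. int (s x)"] by simp
  have jQ: "j \<in> {0..<int q}" "b j > 0" if "j \<in> J" for j using that by (auto simp: J_def Q_def)
  have k_le: "k j \<le> sum s Q" for j
    unfolding k_def by (rule member_le_sum) auto
  have "\<exists>j\<in>J. k j = 0 \<or> size_threshold (k j) \<le> int (b j)"
  proof (rule ccontr)
    assume *: "\<not> ?thesis"
    define T where "T = (\<Sum>j\<in>J. k j)"
    have "J \<noteq> {}" using n_pos by auto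
    hence "B < (\<Sum>j\<in>J. size_threshold (k j))"
      unfolding sum_J[symmetric] using * by (intro sum_strict_mono) auto
    also have "\<dots> = 9 * (\<Sum>j\<in>J. int (k j) * int (k j)) - 5 * int T - 3 * n"
      by (simp add: size_threshold_def sum_subtractf sum_distrib_left T_def power2_eq_square)
    also have "\<dots> \<le> 9 * (\<Sum>j\<in>J. int (k j) * int T) - 5 * int T - 3"
    proof -
      have "(\<Sum>j\<in>J. int (k j) * int (k j)) \<le> (\<Sum>j\<in>J. int (k j) * int T)"
        by (intro sum_mono mult_left_mono) (auto simp: T_def member_le_sum simp del: of_nat_sum)
      thus ?thesis using n_pos by linarith
    qed
    also have "(\<Sum>j\<in>J. int (k j) * int T) = int T * int T"
      by (simp add: T_def sum_distrib_right)
    also have "9 * (int T * int T) - 5 * int T - 3 = size_threshold T"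
      by (simp add: size_threshold_def power2_eq_square)
    also have "\<dots> \<le> size_threshold (sum s Q)"
    proof (rule size_threshold_mono)
      obtain j where "j \<in> J" using \<open>J \<noteq> {}\<close> by blast
      thus "1 \<le> T" using * member_le_sum[of j J k] by (force simp: T_def)
      show "T \<le> sum s Q" using k_sum[OF subsets(2)] by (simp add: T_def flip: of_nat_sum)
    qed
    finally show False using assms(3) by simp
  qed
  then obtain j0 where j0: "j0 \<in> J" "k j0 = 0 \<or> size_threshold (k j0) \<le> int (b j0)" by blast
  have main: "int (a i) + int (b j0) - int (k j0) - 2 \<le> int (f ((i + j0) mod int q))"
  proof (cases "k j0 = 0")
    case True
    thus ?thesis using fib_weak[OF iQ(1) jQ(1)[OF j0(1)] iQ(2) jQ(2)[OF j0(1)]]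
      by (simp add: weak_loss_def k_def)
  next
    case False
    have "size_threshold (k j0) \<le> size_threshold (sum s Q)"
      using False k_le by (intro size_threshold_mono) auto
    thus ?thesis using fib_strong[OF iQ(1) jQ(1)[OF j0(1)] iQ(2) jQ(2)[OF j0(1)]] False j0 assms(2)
      by (simp add: k_def A)
  qed
  have "int (b j) - int (k j) \<le> int (f ((i + j) mod int q))" if "j \<in> J" for j
    using fib_b[OF iQ(1) jQ(1)[OF that] iQ(2) jQ(2)[OF that]] by (simp add: k_def)
  hence "(\<Sum>j\<in>J - {j0}. int (b j) - int (k j)) \<le> (\<Sum>j\<in>J - {j0}. int (f ((i + j) mod int q)))"
    by (intro sum_mono) auto
  with main have "int (a i) - 2 + (\<Sum>j\<in>J. int (b j) - int (k j)) \<le> (\<Sum>j\<in>J. int (f ((i + j) mod int q)))"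
    using j0 by (simp add: sum.remove[of J j0])
  also have "\<dots> = (\<Sum>l\<in>(\<lambda>j. (i + j) mod int q) ` J. int (f l))"
    using sum_row_f[OF subsets(2)] by simp
  also have "\<dots> \<le> F" by (rule sum_mono2) auto
  finally show ?thesis using k_sum[OF subsets(2)] by (simp add: sum_subtractf sum_J A)
qed

end

section \<open>Subgroups of prime index\<close>

text \<open>Subgroups are sets in one fixed type, so that the inductions can descend without
  changing the type.\<close>

definition fin_subgroup :: "'a::ab_group_add set \<Rightarrow> bool" where
  "fin_subgroup H \<longleftrightarrow> finite H \<and> 0 \<in> H \<and> (\<forall>x\<in>H. \<forall>y\<in>H. x - y \<in> H)"

lemma fin_subgroup_uminus: "fin_subgroup H \<Longrightarrow> x \<in> H \<Longrightarrow> - x \<in> H"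
  unfolding fin_subgroup_def by (metis diff_0)

lemma fin_subgroup_add: "fin_subgroup H \<Longrightarrow> x \<in> H \<Longrightarrow> y \<in> H \<Longrightarrow> x + y \<in> H"
  using fin_subgroup_uminus[of H y] unfolding fin_subgroup_def by (metis diff_minus_eq_add)

lemma fin_subgroup_diff: "fin_subgroup H \<Longrightarrow> x \<in> H \<Longrightarrow> y \<in> H \<Longrightarrow> x - y \<in> H"
  by (simp add: fin_subgroup_def)

lemma fin_subgroup_zero: "fin_subgroup H \<Longrightarrow> 0 \<in> H"
  and fin_subgroup_finite: "fin_subgroup H \<Longrightarrow> finite H"
  by (simp_all add: fin_subgroup_def)

primrec nat_mult :: "nat \<Rightarrow> 'a::ab_group_add \<Rightarrow> 'a" where
  "nat_mult 0 x = 0"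
| "nat_mult (Suc n) x = x + nat_mult n x"

lemma nat_mult_add: "nat_mult (m + n) x = nat_mult m x + nat_mult n x"
  by (induction m) (simp_all add: add.assoc)

lemma nat_mult_mult: "nat_mult (m * n) x = nat_mult m (nat_mult n x)"
  by (induction m) (simp_all add: nat_mult_add)

lemma nat_mult_zero [simp]: "nat_mult n 0 = 0"
  by (induction n) simp_all

lemma nat_mult_mem: "fin_subgroup H \<Longrightarrow> x \<in> H \<Longrightarrow> nat_mult n x \<in> H"
  by (induction n) (simp_all add: fin_subgroup_zero fin_subgroup_add)

lemma sum_const_nat_mult: "finite X \<Longrightarrow> (\<Sum>_\<in>X. x) = nat_mult (card X) x"
  by (induction X rule: finite_induct) simp_all

text \<open>Translation by x permutes H, so the sum of all elements changes by |H| x and yet stays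
  the same.\<close>

lemma nat_mult_card:
  assumes "fin_subgroup H" "x \<in> H"
  shows "nat_mult (card H) x = 0"
proof -
  have "bij_betw (\<lambda>h. x + h) H H"
    by (rule bij_betw_byWitness[where f' = "\<lambda>h. h - x"])
      (use assms in \<open>auto intro: fin_subgroup_add fin_subgroup_diff\<close>)
  hence "(\<Sum>h\<in>H. x + h) = (\<Sum>h\<in>H. h)" by (rule sum.reindex_bij_betw)
  thus ?thesis
    using assms by (simp add: sum.distrib sum_const_nat_mult fin_subgroup_finite)
qed

text \<open>The elements congruent to a multiple of x modulo M form a subgroup strictly larger than
  M.\<close>

lemma maximal_subgroup_generates:
  assumes H: "fin_subgroup H" and M: "fin_subgroup M" "M \<subseteq> H"
    and max: "\<And>L. fin_subgroup L \<Longrightarrow> M \<subset> L \<Longrightarrow> L \<subseteq> H \<Longrightarrow> L = H"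
    and x: "x \<in> H" "x \<notin> M" and y: "y \<in> H"
  shows "\<exists>n. y - nat_mult n x \<in> M"
proof -
  define L where "L = {y \<in> H. \<exists>n. y - nat_mult n x \<in> M}"
  have "M \<subseteq> L"
  proof
    fix h assume "h \<in> M"
    moreover from this have "h - nat_mult 0 x \<in> M" by simp
    ultimately show "h \<in> L" using M(2) unfolding L_def by blast
  qed
  moreover have "x - nat_mult 1 x \<in> M" using M(1) by (simp add: fin_subgroup_zero)
  hence "x \<in> L" using x unfolding L_def by blast
  ultimately have "M \<subset> L" using x by blast
  moreover have "fin_subgroup L"
    unfolding fin_subgroup_def
  proof (intro conjI ballI)
    show "finite L" using H by (simp add: L_def fin_subgroup_finite)
    show "0 \<in> L" using \<open>M \<subseteq> L\<close> M(1) fin_subgroup_zero by blast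
    fix u v assume "u \<in> L" "v \<in> L"
    then obtain i j where u: "u \<in> H" "u - nat_mult i x \<in> M" and v: "v \<in> H" "v - nat_mult j x \<in> M"
      by (auto simp: L_def)
    \<comment> \<open>As \<open>nat_mult\<close> takes natural multiples only, -jx is written as
      ((|H| - 1) j) x.\<close>
    have "card H > 0" using H x by (auto simp: card_gt_0_iff fin_subgroup_finite)
    hence "nat_mult ((card H - 1) * j) x + nat_mult j x = nat_mult (card H * j) x"
      by (simp flip: nat_mult_add add: diff_mult_distrib)
    also have "\<dots> = 0"
      using nat_mult_card[OF H x(1)] by (simp add: mult.commute[of _ j] nat_mult_mult)
    finally have "nat_mult ((card H - 1) * j) x = - nat_mult j x"
      by (simp add: eq_neg_iff_add_eq_0)
    hence "(u - v) - nat_mult (i + (card H - 1) * j) x = (u - nat_mult i x) - (v - nat_mult j x)"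
      by (simp add: nat_mult_add)
    also have "\<dots> \<in> M" by (rule fin_subgroup_diff[OF M(1) u(2) v(2)])
    finally show "u - v \<in> L" using u v H fin_subgroup_diff unfolding L_def by blast
  qed
  ultimately have "L = H" using max by (auto simp: L_def)
  thus ?thesis using y by (auto simp: L_def)
qed

text \<open>\<open>\<phi>\<close> is the projection onto H/M followed by an isomorphism with Z/q,
  its values taken as representatives.\<close>

locale prime_index_subgroup =
  fixes H M :: "'a::ab_group_add set" and q :: nat and \<phi> :: "'a \<Rightarrow> int"
  assumes H: "fin_subgroup H" and M: "fin_subgroup M" "M \<subseteq> H"
    and q: "prime q" and card_H: "card H = q * card M"
    and \<phi>_range: "x \<in> H \<Longrightarrow> \<phi> x \<in> {0..<int q}"
    and \<phi>_add: "x \<in> H \<Longrightarrow> y \<in> H \<Longrightarrow> \<phi> (x + y) = (\<phi> x + \<phi> y) mod int q"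
    and \<phi>_zero: "x \<in> H \<Longrightarrow> \<phi> x = 0 \<longleftrightarrow> x \<in> M"

text \<open>Take for M a maximal proper subgroup and for q the order modulo M of some x outside M.
  Every element of H is a multiple of x modulo M, and the multiplier modulo q is \<phi>.\<close>

lemma ex_prime_index_subgroup:
  fixes H :: "'a::ab_group_add set"
  assumes H: "fin_subgroup H" and nontriv: "H \<noteq> {0}"
  shows "\<exists>M q \<phi>. prime_index_subgroup H M q \<phi>"
proof -
  define P where "P = {L. fin_subgroup L \<and> L \<subset> H}"
  have "{0} \<in> P" using H nontriv by (auto simp: P_def fin_subgroup_def)
  moreover have "finite P"
    using fin_subgroup_finite[OF H] by (auto simp: P_def intro: finite_subset[of _ "Pow H"])
  ultimately obtain M where MP: "M \<in> P" and Mmax: "\<And>L. L \<in> P \<Longrightarrow> M \<subseteq> L \<Longrightarrow> M = L"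
    by (metis empty_iff finite_has_maximal)
  have M: "fin_subgroup M" "M \<subset> H" using MP by (auto simp: P_def)
  have max: "L = H" if "fin_subgroup L" "M \<subset> L" "L \<subseteq> H" for L
    using Mmax[of L] that by (auto simp: P_def)
  have gen: "\<exists>n. y - nat_mult n x \<in> M" if "x \<in> H" "x \<notin> M" "y \<in> H" for x y
    using maximal_subgroup_generates[OF H M(1) _ max that] M(2) by blast
  obtain x where x: "x \<in> H" "x \<notin> M" using M(2) by blast
  define q where "q = (LEAST n. 0 < n \<and> nat_mult n x \<in> M)"
  have "0 < card H \<and> nat_mult (card H) x \<in> M"
    using H x nat_mult_card[OF H x(1)] M(1)
    by (auto simp: card_gt_0_iff fin_subgroup_finite fin_subgroup_zero)
  hence q0: "0 < q" "nat_mult q x \<in> M"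
    using LeastI[of "\<lambda>n. 0 < n \<and> nat_mult n x \<in> M" "card H"] by (simp_all add: q_def)
  have least: "n = 0" if "n < q" "nat_mult n x \<in> M" for n
    using not_less_Least[of n "\<lambda>n. 0 < n \<and> nat_mult n x \<in> M"] that by (auto simp: q_def)
  have mem_iff: "nat_mult n x \<in> M \<longleftrightarrow> q dvd n" for n
  proof -
    have 1: "nat_mult (q * (n div q)) x \<in> M"
      using nat_mult_mem[OF M(1) q0(2), of "n div q"] by (simp add: mult.commute[of q] nat_mult_mult)
    have 2: "nat_mult n x = nat_mult (q * (n div q)) x + nat_mult (n mod q) x"
      by (simp flip: nat_mult_add)
    have "nat_mult n x \<in> M \<longleftrightarrow> nat_mult (n mod q) x \<in> M"
    proof
      assume "nat_mult n x \<in> M"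
      from fin_subgroup_diff[OF M(1) this 1] show "nat_mult (n mod q) x \<in> M"
        unfolding 2 by (simp only: add_diff_cancel_left')
    next
      assume "nat_mult (n mod q) x \<in> M"
      from fin_subgroup_add[OF M(1) 1 this] show "nat_mult n x \<in> M"
        by (simp only: 2)
    qed
    also have "\<dots> \<longleftrightarrow> q dvd n"
    proof
      assume "nat_mult (n mod q) x \<in> M"
      hence "n mod q = 0" using q0(1) by (intro least) simp_all
      thus "q dvd n" by (simp add: dvd_eq_mod_eq_0)
    next
      assume "q dvd n"
      thus "nat_mult (n mod q) x \<in> M" using M(1) by (simp add: fin_subgroup_zero)
    qed
    finally show ?thesis .
  qed
  have le_cong: "int q dvd int i - int j"
    if "y - nat_mult i x \<in> M" "y - nat_mult j x \<in> M" "j \<le> i" for y i j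
  proof -
    have "nat_mult i x = nat_mult (i - j) x + nat_mult j x"
      using that by (simp flip: nat_mult_add)
    hence "nat_mult (i - j) x = (y - nat_mult j x) - (y - nat_mult i x)" by simp
    hence "nat_mult (i - j) x \<in> M" using that fin_subgroup_diff[OF M(1)] by metis
    hence "int q dvd int (i - j)" using mem_iff by simp
    thus ?thesis using that by (simp add: of_nat_diff)
  qed
  have cong: "int i mod int q = int j mod int q"
    if "y - nat_mult i x \<in> M" "y - nat_mult j x \<in> M" for y i j
    using le_cong[of y i j] le_cong[of y j i] that
    by (metis dvd_diff_commute linorder_le_cases mod_eq_dvd_iff)
  define \<phi> :: "'a \<Rightarrow> int" where "\<phi> y = int (SOME n. y - nat_mult n x \<in> M) mod int q" for y
  have \<phi>: "\<phi> y = int n mod int q" if "y - nat_mult n x \<in> M" for y n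
    unfolding \<phi>_def using that by (intro cong[of y]) (rule someI)
  have prime: "prime q"
    unfolding prime_nat_iff
  proof (intro conjI allI impI)
    have "q \<noteq> 1" using q0(2) x by auto
    thus "1 < q" using q0 by simp
    fix d assume d: "d dvd q"
    show "d = 1 \<or> d = q"
    proof (rule ccontr)
      assume nd: "\<not> ?thesis"
      \<comment> \<open>By maximality dx again generates H modulo M, so x is congruent to some ndx,
        and d, as a divisor of q, divides nd - 1.\<close>
      hence "nat_mult d x \<notin> M"
        using d q0 mem_iff by (metis dvd_antisym)
      then obtain n where "x - nat_mult n (nat_mult d x) \<in> M"
        using gen[OF nat_mult_mem[OF H x(1)] _ x(1)] by blast
      hence "x - nat_mult (n * d) x \<in> M" by (simp add: nat_mult_mult)
      moreover have "x - nat_mult 1 x \<in> M" using M(1) by (simp add: fin_subgroup_zero)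
      ultimately have "int q dvd int (n * d) - int 1"
        using cong by (metis mod_eq_dvd_iff)
      hence "int d dvd int (n * d) - int 1" using d by (meson dvd_trans int_dvd_int_iff)
      hence "int d dvd 1" by (simp add: dvd_diff_right_iff)
      thus False using nd by simp
    qed
  qed
  have card: "card H = q * card M"
  proof -
    define g where "g = (\<lambda>(h, n). h + nat_mult n x)"
    have "inj_on g (M \<times> {..<q})"
    proof (rule inj_onI, clarify)
      fix h n h' n' assume *: "h \<in> M" "h' \<in> M" "n < q" "n' < q" "g (h, n) = g (h', n')"
      have "g (h, n) - nat_mult n x \<in> M" using *(1) by (simp add: g_def)
      moreover have "g (h, n) - nat_mult n' x \<in> M" unfolding *(5) using *(2) by (simp add: g_def)
      ultimately have "int n mod int q = int n' mod int q" by (rule cong)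
      hence "n = n'" using * by simp
      thus "h = h' \<and> n = n'" using * by (simp add: g_def)
    qed
    moreover have "g ` (M \<times> {..<q}) = H"
    proof
      show "g ` (M \<times> {..<q}) \<subseteq> H"
        using M(2) x nat_mult_mem[OF H x(1)] fin_subgroup_add[OF H] by (auto simp: g_def)
      show "H \<subseteq> g ` (M \<times> {..<q})"
      proof
        fix y assume y: "y \<in> H"
        then obtain n where n: "y - nat_mult n x \<in> M" using gen[OF x] by blast
        have "nat_mult n x = nat_mult (q * (n div q)) x + nat_mult (n mod q) x"
          by (simp flip: nat_mult_add)
        hence "y - nat_mult (n mod q) x = (y - nat_mult n x) + nat_mult (q * (n div q)) x" by simp
        also have "\<dots> \<in> M" using n mem_iff M(1) by (intro fin_subgroup_add) auto
        finally show "y \<in> g ` (M \<times> {..<q})"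
          using q0 by (intro image_eqI[of _ _ "(y - nat_mult (n mod q) x, n mod q)"]) (auto simp: g_def)
      qed
    qed
    ultimately have "card H = card (M \<times> {..<q})" by (metis card_image)
    thus ?thesis by (simp add: card_cartesian_product mult.commute)
  qed
  have "prime_index_subgroup H M q \<phi>"
  proof
    show "\<phi> y \<in> {0..<int q}" for y using q0 by (simp add: \<phi>_def)
    fix y assume y: "y \<in> H"
    obtain n where n: "y - nat_mult n x \<in> M" using gen[OF x y] by blast
    show "\<phi> y = 0 \<longleftrightarrow> y \<in> M"
    proof -
      have "\<phi> y = 0 \<longleftrightarrow> nat_mult n x \<in> M"
        using \<phi>[OF n] mem_iff[of n] by (metis dvd_eq_mod_eq_0 int_dvd_int_iff)
      also have "\<dots> \<longleftrightarrow> y \<in> M"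
      proof
        assume "nat_mult n x \<in> M"
        from fin_subgroup_add[OF M(1) n this] show "y \<in> M" by simp
      next
        assume "y \<in> M"
        from fin_subgroup_diff[OF M(1) this n] show "nat_mult n x \<in> M" by simp
      qed
      finally show ?thesis .
    qed
    fix z assume z: "z \<in> H"
    obtain k where k: "z - nat_mult k x \<in> M" using gen[OF x z] by blast
    have "(y + z) - nat_mult (n + k) x = (y - nat_mult n x) + (z - nat_mult k x)"
      by (simp add: nat_mult_add)
    also have "\<dots> \<in> M" using n k by (intro fin_subgroup_add[OF M(1)])
    finally show "\<phi> (y + z) = (\<phi> y + \<phi> z) mod int q"
      using \<phi> n k by (simp add: mod_add_eq)
  qed (use H M prime card in auto)
  thus ?thesis by blast
qed

section \<open>Restricted sumsets in finite abelian groups\<close>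

lemma finite_restricted_sumset:
  assumes "finite A" "finite B"
  shows "finite (restricted_sumset S A B)"
proof (rule finite_subset)
  show "restricted_sumset S A B \<subseteq> (\<lambda>(a, b). a + b) ` (A \<times> B)"
    by (auto simp: restricted_sumset_def)
qed (use assms in simp)

lemma restricted_sumset_commute:
  "restricted_sumset S A B = restricted_sumset (uminus ` S) B A"
proof -
  have neg: "b - a \<in> uminus ` S \<longleftrightarrow> a - b \<in> S" for a b
  proof
    assume "a - b \<in> S"
    thus "b - a \<in> uminus ` S" by (intro image_eqI[of _ _ "a - b"]) simp_all
  next
    assume "b - a \<in> uminus ` S"
    then obtain s where "s \<in> S" "b - a = - s" by blast
    thus "a - b \<in> S" by (metis minus_diff_eq minus_minus)
  qed
  have "x \<in> restricted_sumset S A B \<longleftrightarrow> x \<in> restricted_sumset (uminus ` S) B A" for x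
    unfolding restricted_sumset_def mem_Collect_eq neg by (metis add.commute)
  thus ?thesis by blast
qed

lemma card_le_restricted_sumset:
  assumes "finite A" "finite B" "finite S" "B \<noteq> {}"
  shows "card A \<le> card (restricted_sumset S A B) + card S"
proof -
  obtain b where b: "b \<in> B" using assms by blast
  define A' where "A' = {a \<in> A. a - b \<in> S}"
  have "card (A - A') \<le> card (restricted_sumset S A B)"
    using b by (intro card_inj_on_le[of "\<lambda>a. a + b"] finite_restricted_sumset assms)
      (auto simp: A'_def restricted_sumset_def inj_on_def)
  moreover have "card A' \<le> card S"
    using assms by (intro card_inj_on_le[of "\<lambda>a. a - b"]) (auto simp: A'_def inj_on_def)
  moreover have "card A = card (A - A') + card A'"
    using assms(1) card_Diff_subset[of A' A] card_mono[of A A'] by (auto simp: A'_def)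
  ultimately show ?thesis by linarith
qed

lemma card_le_restricted_sumset':
  assumes "finite A" "finite B" "finite S" "A \<noteq> {}"
  shows "card B \<le> card (restricted_sumset S A B) + card S"
  using card_le_restricted_sumset[of B A "uminus ` S"] assms restricted_sumset_commute[of S A B]
  by (simp add: card_image inj_on_def)

lemma restricted_sumset_subset:
  assumes "fin_subgroup H" "A \<subseteq> H" "B \<subseteq> H"
  shows "restricted_sumset S A B \<subseteq> H"
  using assms fin_subgroup_add unfolding restricted_sumset_def by blast

lemma fin_subgroup_uminus_image:
  "fin_subgroup H \<Longrightarrow> S \<subseteq> H \<Longrightarrow> uminus ` S \<subseteq> H"
  using fin_subgroup_uminus by blast

section \<open>Fibres over the quotient by a subgroup of prime index\<close>

context prime_index_subgroup
begin

lemma q_pos: "q > 0"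
  using q prime_gt_0_nat by blast

lemma \<phi>_diff:
  assumes "x \<in> H" "y \<in> H"
  shows "\<phi> (x - y) = (\<phi> x - \<phi> y) mod int q"
proof -
  have "\<phi> x = (\<phi> (x - y) + \<phi> y) mod int q"
    using \<phi>_add[of "x - y" y] assms fin_subgroup_diff[OF H] by simp
  hence "(\<phi> x - \<phi> y) mod int q = \<phi> (x - y) mod int q"
    by (metis add_diff_cancel_right' mod_diff_left_eq)
  thus ?thesis using \<phi>_range[of "x - y"] assms fin_subgroup_diff[OF H] by simp
qed

lemma diff_in_M_iff:
  assumes "x \<in> H" "y \<in> H"
  shows "x - y \<in> M \<longleftrightarrow> \<phi> x = \<phi> y"
proof -
  have "x - y \<in> M \<longleftrightarrow> (\<phi> x - \<phi> y) mod int q = 0"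
    using \<phi>_zero[of "x - y"] \<phi>_diff[OF assms] assms fin_subgroup_diff[OF H] by simp
  also have "\<dots> \<longleftrightarrow> \<phi> x mod int q = \<phi> y mod int q"
    by (simp add: mod_eq_dvd_iff dvd_eq_mod_eq_0)
  also have "\<dots> \<longleftrightarrow> \<phi> x = \<phi> y" using \<phi>_range assms by simp
  finally show ?thesis .
qed

definition "fibre A i = {x \<in> A. \<phi> x = i}"

lemma finite_H: "A \<subseteq> H \<Longrightarrow> finite A"
  using fin_subgroup_finite[OF H] finite_subset by blast

lemma sum_card_fibre:
  assumes "A \<subseteq> H"
  shows "(\<Sum>i\<in>{0..<int q}. card (fibre A i)) = card A"
proof -
  have "(\<Sum>i\<in>{0..<int q}. sum (\<lambda>_. 1) {x \<in> A. \<phi> x = i}) = sum (\<lambda>_. 1::nat) A"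
    using assms \<phi>_range finite_H[OF assms] by (intro sum.group) auto
  thus ?thesis by (simp add: fibre_def)
qed

lemma nonempty_fibres:
  assumes "A \<subseteq> H"
  shows "{i \<in> {0..<int q}. card (fibre A i) > 0} = \<phi> ` A"
proof -
  have "finite (fibre A i)" for i using finite_H[OF assms] by (simp add: fibre_def)
  thus ?thesis using assms \<phi>_range by (fastforce simp: card_gt_0_iff fibre_def)
qed

text \<open>The bounds inside M concern subsets of M, whereas fibres lie in cosets. Shifts by x, y
  and x - y are compatible, since (a - x) - (b - y) = (a - b) - (x - y).\<close>

lemma fibre_translate:
  assumes sub: "A \<subseteq> H" "B \<subseteq> H" "S \<subseteq> H" and ne: "fibre A i \<noteq> {}" "fibre B j \<noteq> {}"
  shows "\<exists>A' B' S'. A' \<subseteq> M \<and> B' \<subseteq> M \<and> S' \<subseteq> M \<and> A' \<noteq> {} \<and> B' \<noteq> {} \<and>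
    card A' = card (fibre A i) \<and> card B' = card (fibre B j) \<and>
    card S' = card (fibre S ((i - j) mod int q)) \<and>
    card (restricted_sumset S' A' B') \<le> card (fibre (restricted_sumset S A B) ((i + j) mod int q))"
proof -
  obtain x y where x: "x \<in> H" "\<phi> x = i" and y: "y \<in> H" "\<phi> y = j"
    using ne sub by (auto simp: fibre_def)
  define A' where "A' = (\<lambda>a. a - x) ` fibre A i"
  define B' where "B' = (\<lambda>b. b - y) ` fibre B j"
  define S' where "S' = (\<lambda>s. s - (x - y)) ` fibre S ((i - j) mod int q)"
  have xy: "x - y \<in> H" "\<phi> (x - y) = (i - j) mod int q"
    using x y \<phi>_diff fin_subgroup_diff[OF H] by auto
  have AB: "A' \<subseteq> M" "B' \<subseteq> M" "S' \<subseteq> M"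
    using sub x y xy diff_in_M_iff by (auto simp: A'_def B'_def S'_def fibre_def subset_iff)
  have fin: "finite A'" "finite B'"
    using AB M(2) finite_H by (meson subset_trans)+
  have fin': "finite (restricted_sumset S A B)"
    using sub finite_H by (intro finite_restricted_sumset)
  have "card (restricted_sumset S' A' B') \<le> card (fibre (restricted_sumset S A B) ((i + j) mod int q))"
  proof (rule card_inj_on_le[of "\<lambda>c. c + (x + y)"])
    show "(\<lambda>c. c + (x + y)) ` restricted_sumset S' A' B'
        \<subseteq> fibre (restricted_sumset S A B) ((i + j) mod int q)"
    proof clarify
      fix c assume "c \<in> restricted_sumset S' A' B'"
      then obtain a b where ab: "a \<in> fibre A i" "b \<in> fibre B j" "c = (a - x) + (b - y)"
        "(a - x) - (b - y) \<notin> S'"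
        by (auto simp: restricted_sumset_def A'_def B'_def)
      have H': "a \<in> H" "b \<in> H" "\<phi> a = i" "\<phi> b = j" using ab sub by (auto simp: fibre_def)
      have "a - b \<notin> S"
      proof
        assume "a - b \<in> S"
        hence "a - b \<in> fibre S ((i - j) mod int q)"
          using H' \<phi>_diff by (simp add: fibre_def)
        hence "(a - b) - (x - y) \<in> S'" by (simp add: S'_def)
        thus False using ab(4) by (simp add: algebra_simps)
      qed
      moreover have "c + (x + y) = a + b" using ab(3) by (simp add: algebra_simps)
      moreover have "\<phi> (a + b) = (i + j) mod int q" using H' \<phi>_add by simp
      ultimately show "c + (x + y) \<in> fibre (restricted_sumset S A B) ((i + j) mod int q)"
        using ab by (auto simp: fibre_def restricted_sumset_def)
    qed
    show "finite (fibre (restricted_sumset S A B) ((i + j) mod int q))"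
      using fin' by (simp add: fibre_def)
  qed (simp add: inj_on_def)
  moreover have "card A' = card (fibre A i)" "card B' = card (fibre B j)"
    "card S' = card (fibre S ((i - j) mod int q))"
    unfolding A'_def B'_def S'_def by (simp_all add: card_image inj_on_def)
  moreover have "A' \<noteq> {}" "B' \<noteq> {}" using ne by (simp_all add: A'_def B'_def)
  ultimately show ?thesis using AB by blast
qed

lemma fibration_restricted_sumset:
  assumes sub: "A \<subseteq> H" "B \<subseteq> H" "S \<subseteq> H" and ne: "A \<noteq> {}" "B \<noteq> {}"
    and p: "p \<le> q" "card (restricted_sumset S A B) < p" and S: "card S < q"
    and weak: "\<And>A' B' S'. A' \<subseteq> M \<Longrightarrow> B' \<subseteq> M \<Longrightarrow> S' \<subseteq> M \<Longrightarrow> A' \<noteq> {} \<Longrightarrow> B' \<noteq> {} \<Longrightarrow>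
      min (int p) (int (card A') + int (card B') - weak_loss (card S'))
        \<le> int (card (restricted_sumset S' A' B'))"
  shows "fibration q p (\<lambda>i. card (fibre A i)) (\<lambda>i. card (fibre B i)) (\<lambda>i. card (fibre S i))
    (\<lambda>i. card (fibre (restricted_sumset S A B) i))"
proof
  have C: "restricted_sumset S A B \<subseteq> H"
    by (rule restricted_sumset_subset[OF H sub(1,2)])
  show "(\<Sum>l\<in>{0..<int q}. card (fibre (restricted_sumset S A B) l)) < p"
    using p sum_card_fibre[OF C] by simp
  have "card (\<phi> ` S) \<le> card S" using finite_H[OF sub(3)] card_image_le by blast
  thus "card {k \<in> {0..<int q}. 0 < card (fibre S k)} < q"
    using S by (simp only: nonempty_fibres[OF sub(3)])
  show "{i \<in> {0..<int q}. 0 < card (fibre A i)} \<noteq> {}" "{j \<in> {0..<int q}. 0 < card (fibre B j)} \<noteq> {}"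
    using ne by (simp_all only: nonempty_fibres[OF sub(1)] nonempty_fibres[OF sub(2)] image_is_empty
        not_False_eq_True)
  fix i j assume "card (fibre A i) > 0" "card (fibre B j) > 0"
  hence "fibre A i \<noteq> {}" "fibre B j \<noteq> {}" by auto
  from fibre_translate[OF sub this] obtain A' B' S' where
    t: "A' \<subseteq> M" "B' \<subseteq> M" "S' \<subseteq> M" "A' \<noteq> {}" "B' \<noteq> {}" "card A' = card (fibre A i)"
    "card B' = card (fibre B j)" "card S' = card (fibre S ((i - j) mod int q))"
    "card (restricted_sumset S' A' B') \<le> card (fibre (restricted_sumset S A B) ((i + j) mod int q))"
    by blast
  have fin: "finite A'" "finite B'" "finite S'" using t M(2) finite_H by (meson subset_trans)+
  show "card (fibre A i) \<le> card (fibre (restricted_sumset S A B) ((i + j) mod int q)) +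
      card (fibre S ((i - j) mod int q))"
    using card_le_restricted_sumset[OF fin t(5)] t by linarith
  show "card (fibre B j) \<le> card (fibre (restricted_sumset S A B) ((i + j) mod int q)) +
      card (fibre S ((i - j) mod int q))"
    using card_le_restricted_sumset'[OF fin t(4)] t by linarith
  \<comment> \<open>Every fibre has fewer than p elements, so the minimum in \<open>weak\<close> is
    not p.\<close>
  have "card (fibre (restricted_sumset S A B) l) \<le> card (restricted_sumset S A B)" for l
    using finite_H[OF C] by (intro card_mono) (auto simp: fibre_def)
  hence "card (restricted_sumset S' A' B') < p" using t(9) p(2) by (meson le_less_trans)
  thus "int (card (fibre A i)) + int (card (fibre B j)) \<le>
      int (card (fibre (restricted_sumset S A B) ((i + j) mod int q))) +
      weak_loss (card (fibre S ((i - j) mod int q)))"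
    using weak[OF t(1-5)] t(6-9) by (simp add: min_def split: if_splits)
qed (use q p in auto)

end

text \<open>Taking for \<open>p\<close> any lower bound of the prime factors of |H|, and not the
  least one, lets the hypothesis pass to M.\<close>

theorem card_restricted_sumset_weak:
  fixes H :: "'a::ab_group_add set"
  assumes "fin_subgroup H" "A \<subseteq> H" "B \<subseteq> H" "S \<subseteq> H" "A \<noteq> {}" "B \<noteq> {}"
    and "\<And>r. prime r \<Longrightarrow> r dvd card H \<Longrightarrow> p \<le> r"
  shows "min (int p) (int (card A) + int (card B) - weak_loss (card S))
    \<le> int (card (restricted_sumset S A B))"
  using assms
proof (induction "card H" arbitrary: H A B S rule: less_induct)
  case less
  note H = \<open>fin_subgroup H\<close>
  have fin: "finite X" if "X \<subseteq> H" for X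
    using that fin_subgroup_finite[OF H] finite_subset by blast
  show ?case
  proof (cases "H = {0}")
    case True
    hence "A = {0}" "B = {0}" using less.prems by auto
    moreover have "card A \<le> card (restricted_sumset S A B) + card S"
      using less.prems fin by (intro card_le_restricted_sumset) auto
    ultimately show ?thesis by (auto simp: weak_loss_def)
  next
    case False
    show ?thesis
    proof (rule ccontr)
      assume contr: "\<not> ?thesis"
      define c where "c = card (restricted_sumset S A B)"
      have cp: "c < p" using contr by (simp add: c_def)
      have c: "card A \<le> c + card S" "card B \<le> c + card S"
        unfolding c_def using less.prems fin
        by (auto intro!: card_le_restricted_sumset card_le_restricted_sumset')
      have Sp: "card S < p"
      proof (rule ccontr)
        assume "\<not> card S < p"
        hence "int (card A) + int (card B) - weak_loss (card S) \<le> 0"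
          using c cp by (simp add: weak_loss_def)
        thus False using contr by simp
      qed
      obtain M q \<phi> where "prime_index_subgroup H M q \<phi>"
        using ex_prime_index_subgroup[OF H False] by blast
      then interpret prime_index_subgroup H M q \<phi> .
      have "p \<le> q" using less.prems(7)[OF q] card_H by simp
      have "card M < card H"
        using card_H prime_gt_1_nat[OF q] fin_subgroup_finite[OF M(1)] fin_subgroup_zero[OF M(1)]
        by (auto simp: card_gt_0_iff)
      have weak: "min (int p) (int (card A') + int (card B') - weak_loss (card S'))
        \<le> int (card (restricted_sumset S' A' B'))"
        if "A' \<subseteq> M" "B' \<subseteq> M" "S' \<subseteq> M" "A' \<noteq> {}" "B' \<noteq> {}" for A' B' S'
        using less.hyps[OF \<open>card M < card H\<close> M(1) that] less.prems(7) card_H by simp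
      \<comment> \<open>Stated for arbitrary sets, so that it also serves for B, A and -S when B
        meets fewer classes.\<close>
      have main: "int (card A) + int (card B) - weak_loss (card S) \<le> int (card (restricted_sumset S A B))"
        if sub: "A \<subseteq> H" "B \<subseteq> H" "S \<subseteq> H" and ne: "A \<noteq> {}" "B \<noteq> {}"
          and less: "card (restricted_sumset S A B) < p" "card S < q"
          and mn: "card (\<phi> ` A) \<le> card (\<phi> ` B)" for A B S
      proof -
        interpret fib: fibration q p "\<lambda>i. card (fibre A i)" "\<lambda>i. card (fibre B i)"
          "\<lambda>i. card (fibre S i)" "\<lambda>i. card (fibre (restricted_sumset S A B) i)"
          using fibration_restricted_sumset[OF sub ne \<open>p \<le> q\<close> less weak] .
        have C: "restricted_sumset S A B \<subseteq> H"
          by (rule restricted_sumset_subset[OF H sub(1,2)])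
        have "card fib.I \<le> card fib.J"
          using mn nonempty_fibres[OF sub(1)] nonempty_fibres[OF sub(2)]
          by (simp add: fib.I_def fib.J_def fib.Q_def)
        thus ?thesis
          using fib.weak_bound sum_card_fibre[OF sub(1)] sum_card_fibre[OF sub(2)]
            sum_card_fibre[OF sub(3)] sum_card_fibre[OF C]
          by (simp add: fib.Q_def flip: of_nat_sum)
      qed
      have "int (card A) + int (card B) - weak_loss (card S) \<le> int c"
      proof (cases "card (\<phi> ` A) \<le> card (\<phi> ` B)")
        case True
        thus ?thesis
          using main[of A B S] less.prems cp Sp \<open>p \<le> q\<close> by (simp add: c_def)
      next
        case False
        thus ?thesis
          using main[of B A "uminus ` S"] less.prems cp Sp \<open>p \<le> q\<close> fin_subgroup_uminus_image[OF H]
          by (simp add: c_def restricted_sumset_commute[of S A B] card_image inj_on_def)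
      qed
      thus False using contr by (simp add: c_def)
    qed
  qed
qed

text \<open>The induction hypothesis enters only when the set meeting fewer classes lies in a single
  coset; with two or more fibres the weak bound inside M is enough.\<close>

theorem card_restricted_sumset_strong:
  fixes H :: "'a::ab_group_add set"
  assumes "fin_subgroup H" "A \<subseteq> H" "B \<subseteq> H" "S \<subseteq> H" "A \<noteq> {}" "B \<noteq> {}" "S \<noteq> {}"
    and "\<And>r. prime r \<Longrightarrow> r dvd card H \<Longrightarrow> p \<le> r"
    and "size_threshold (card S) \<le> int (card A)" "size_threshold (card S) \<le> int (card B)"
  shows "min (int p) (int (card A) + int (card B) - int (card S) - 2)
    \<le> int (card (restricted_sumset S A B))"
  using assms
proof (induction "card H" arbitrary: H A B S rule: less_induct)
  case less
  note H = \<open>fin_subgroup H\<close>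
  note p = less.prems(8)
  have fin: "finite X" if "X \<subseteq> H" for X
    using that fin_subgroup_finite[OF H] finite_subset by blast
  have "card S \<ge> 1" using fin[OF less.prems(4)] less.prems(7) by (simp add: Suc_le_eq card_gt_0_iff)
  show ?case
  proof (cases "card S = 1")
    case True
    thus ?thesis
      using card_restricted_sumset_weak[OF less.prems(1-6) p] by (simp add: weak_loss_def)
  next
    case False
    hence S2: "card S \<ge> 2" using \<open>card S \<ge> 1\<close> by simp
    have "H \<noteq> {0}"
      using S2 card_mono[of H S] less.prems(4) fin_subgroup_finite[OF H] by auto
    show ?thesis
    proof (rule ccontr)
      assume contr: "\<not> ?thesis"
      define c where "c = card (restricted_sumset S A B)"
      have cp: "c < p" using contr by (simp add: c_def)
      \<comment> \<open>From |A| \<le> c + |S| < p + |S|, as the threshold is at least 2|S| for |S|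
        \<ge> 2.\<close>
      have Sp: "card S < p"
      proof -
        have "card A \<le> c + card S"
          unfolding c_def using less.prems fin by (auto intro!: card_le_restricted_sumset)
        moreover have "int (card S) * 2 \<le> int (card S) * int (card S)"
          using S2 by (intro mult_left_mono) auto
        ultimately show ?thesis
          using less.prems(9) cp S2 unfolding size_threshold_def power2_eq_square by linarith
      qed
      obtain M q \<phi> where "prime_index_subgroup H M q \<phi>"
        using ex_prime_index_subgroup[OF H \<open>H \<noteq> {0}\<close>] by blast
      then interpret prime_index_subgroup H M q \<phi> .
      have "p \<le> q" using p[OF q] card_H by simp
      have pM: "\<And>r. prime r \<Longrightarrow> r dvd card M \<Longrightarrow> p \<le> r" using p card_H by simp
      have "card M < card H"
        using card_H prime_gt_1_nat[OF q] fin_subgroup_finite[OF M(1)] fin_subgroup_zero[OF M(1)]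
        by (auto simp: card_gt_0_iff)
      have weak: "min (int p) (int (card A') + int (card B') - weak_loss (card S'))
        \<le> int (card (restricted_sumset S' A' B'))"
        if "A' \<subseteq> M" "B' \<subseteq> M" "S' \<subseteq> M" "A' \<noteq> {}" "B' \<noteq> {}" for A' B' S'
        using card_restricted_sumset_weak[OF M(1) that pM] .
      have main: "int (card A) + int (card B) - int (card S) - 2 \<le> int (card (restricted_sumset S A B))"
        if sub: "A \<subseteq> H" "B \<subseteq> H" "S \<subseteq> H" and ne: "A \<noteq> {}" "B \<noteq> {}"
          and less': "card (restricted_sumset S A B) < p" "card S < q" "2 \<le> card S"
          and thr: "size_threshold (card S) \<le> int (card A)" "size_threshold (card S) \<le> int (card B)"
          and mn: "card (\<phi> ` A) \<le> card (\<phi> ` B)" for A B S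
      proof -
        interpret fib: fibration q p "\<lambda>i. card (fibre A i)" "\<lambda>i. card (fibre B i)"
          "\<lambda>i. card (fibre S i)" "\<lambda>i. card (fibre (restricted_sumset S A B) i)"
          using fibration_restricted_sumset[OF sub ne \<open>p \<le> q\<close> less'(1,2) weak] .
        have C: "restricted_sumset S A B \<subseteq> H"
          by (rule restricted_sumset_subset[OF H sub(1,2)])
        have mn': "card fib.I \<le> card fib.J"
          using mn nonempty_fibres[OF sub(1)] nonempty_fibres[OF sub(2)]
          by (simp add: fib.I_def fib.J_def fib.Q_def)
        note sums = sum_card_fibre[OF sub(1), folded fib.Q_def] sum_card_fibre[OF sub(2), folded fib.Q_def]
          sum_card_fibre[OF sub(3), folded fib.Q_def] sum_card_fibre[OF C, folded fib.Q_def]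
        note isums = sums[THEN arg_cong[of _ _ int], unfolded of_nat_sum]
        show ?thesis
        proof (cases "card fib.I \<ge> 2")
          case True
          thus ?thesis
            using fib.strong_bound mn' thr less'(3) unfolding sums isums by simp
        next
          case False
          hence "int (card fib.I) = 1" using fib.m_pos by linarith
          have strong: "int (card (fibre A i)) + int (card (fibre B j)) \<le>
              int (card (fibre (restricted_sumset S A B) ((i + j) mod int q))) +
              int (card (fibre S ((i - j) mod int q))) + 2"
            if "card (fibre A i) > 0" "card (fibre B j) > 0" "card (fibre S ((i - j) mod int q)) > 0"
              "size_threshold (card (fibre S ((i - j) mod int q))) \<le> int (card (fibre A i))"
              "size_threshold (card (fibre S ((i - j) mod int q))) \<le> int (card (fibre B j))" for i j
          proof -
            have "fibre A i \<noteq> {}" "fibre B j \<noteq> {}" using that by auto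
            from fibre_translate[OF sub this] obtain A' B' S' where
              t: "A' \<subseteq> M" "B' \<subseteq> M" "S' \<subseteq> M" "A' \<noteq> {}" "B' \<noteq> {}" "card A' = card (fibre A i)"
              "card B' = card (fibre B j)" "card S' = card (fibre S ((i - j) mod int q))"
              "card (restricted_sumset S' A' B') \<le> card (fibre (restricted_sumset S A B) ((i + j) mod int q))"
              by blast
            have "S' \<noteq> {}" using t(8) that(3) by auto
            have "min (int p) (int (card A') + int (card B') - int (card S') - 2)
                \<le> int (card (restricted_sumset S' A' B'))"
              by (rule less.hyps[OF \<open>card M < card H\<close> M(1) t(1-5) \<open>S' \<noteq> {}\<close> pM])
                (use t that in simp_all)
            moreover have "card (fibre (restricted_sumset S A B) l) \<le> card (restricted_sumset S A B)" for l
              using finite_H[OF C] by (intro card_mono) (auto simp: fibre_def)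
            hence "card (restricted_sumset S' A' B') < p" using t(9) less'(1) by (meson le_less_trans)
            ultimately show ?thesis
              using t(6-9) by (simp add: min_def split: if_splits)
          qed
          show ?thesis
            using fib.strong_bound_single_fibre[OF \<open>int (card fib.I) = 1\<close>] thr strong
            unfolding sums isums by simp
        qed
      qed
      have "int (card A) + int (card B) - int (card S) - 2 \<le> int c"
      proof (cases "card (\<phi> ` A) \<le> card (\<phi> ` B)")
        case True
        thus ?thesis
          using main[of A B S] less.prems cp Sp S2 \<open>p \<le> q\<close> by (simp add: c_def)
      next
        case False
        thus ?thesis
          using main[of B A "uminus ` S"] less.prems cp Sp S2 \<open>p \<le> q\<close> fin_subgroup_uminus_image[OF H]
          by (simp add: c_def restricted_sumset_commute[of S A B] card_image inj_on_def)
      qed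
      thus False using contr by (simp add: c_def)
    qed
  qed
qed

theorem theorem1p2:
  fixes A B S :: "'a::{ab_group_add, finite} set"
  assumes "A \<noteq> {}" and "B \<noteq> {}" and "S \<noteq> {}"
    and "int (min (card A) (card B)) \<ge> 9 * int (card S)^2 - 5 * int (card S) - 3"
  shows "int (card (restricted_sumset S A B))
           \<ge> min (int (card A) + int (card B) - int (card S) - 2)
                 (int (least_prime_factor_grp TYPE('a)))"
proof -
  have "fin_subgroup (UNIV :: 'a set)" by (simp add: fin_subgroup_def)
  \<comment> \<open>In the trivial group \<open>Min\<close> is applied to the empty set and its
    value is unknown, but no prime divides 1, so the condition holds vacuously.\<close>
  moreover have "least_prime_factor_grp TYPE('a) \<le> r" if "prime r" "r dvd card (UNIV :: 'a set)" for r
    unfolding least_prime_factor_grp_def using that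
    by (intro Min_le) (simp_all add: in_prime_factors_iff)
  ultimately show ?thesis
    using card_restricted_sumset_strong[of UNIV A B S "least_prime_factor_grp TYPE('a)"] assms
    by (simp add: size_threshold_def min.commute)
qed

end
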